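(* Let $d\ge 2$, let $\Gamma$ be a connected locally finite $\mathbb{Z}^d$-periodic graph, let $Q$ be a real-valued $\mathbb{Z}^d$-periodic potential on its vertex set $V$, and let $H=\Delta+Q$ be the Schrödinger operator on $\ell^2(V)$. With the notation fixed in the context, each spectral band $\sigma_n(H)=[\lambda_n^-,\lambda_n^+]$ of $H$ satisfies $$\sigma_n(H)\subset J_n\cap\widetilde J_n,\qquad n=1,\ldots,\nu,$$ where the intervals $J_n,\widetilde J_n$ are given by $$J_n=\begin{cases}[\lambda_n^N,\lambda_n^D], & n=1,\ldots,\nu_D,\\ [\lambda_n^N,\,q_n^\bullet+2\varkappa_+], & n=\nu_D+1,\ldots,\nu,\end{cases}$$ and $$\widetilde J_n=\begin{cases}[q_n^\bullet,\,\lambda^N_{n+\nu_N-\nu}], & n=1,\ldots,\nu-\nu_D,\\ [\lambda^D_{n-\nu+\nu_D},\,\lambda^N_{n+\nu_N-\nu}], & n=\nu-\nu_D+1,\ldots,\nu.\end{cases}$$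
   Context: **Periodic graph.** $\Gamma=(V,\mathcal{E})$ is a connected graph with vertex set $V\subset\mathbb{R}^d$ and set $\mathcal{E}$ of unoriented edges; loops and multiple edges are allowed. An edge joining $u$ and $v$ is written $(u,v)_e$. The degree $\varkappa_v$ of $v\in V$ is the number of edges incident to $v$, a loop being counted twice. $\Gamma$ is $\mathbb{Z}^d$-periodic and locally finite: every bounded domain of $\mathbb{R}^d$ contains finitely many vertices, every degree is finite, and there is a basis $a_1,\ldots,a_d$ of $\mathbb{R}^d$ with $\Gamma+a_s=\Gamma$ for all $s$ (as a graph, including edges). Points of $\mathbb{R}^d$ are expressed in coordinates with respect to $a_1,\ldots,a_d$ and a fixed origin $O$, so $\Gamma+m=\Gamma$ for all $m\in\mathbb{Z}^d$. Put $\varkappa_+=\sup_{v\in V}\varkappa_v<\infty$ and $V_F=[0,1)^d\cap V=\{v_1,\ldots,v_\nu\}$, $\nu=\#V_F<\infty$. Write $\varkappa_j=\varkappa_{v_j}$. **Operator.** On $\ell^2(V)$, $(\Delta f)(v)=\sum_{(v,u)_e\in\mathcal{E}}(f(v)-f(u))$ and $(Qf)(v)=Q(v)f(v)$, where $Q:V\to\mathbb{R}$ satisfies $Q(v+m)=Q(v)$ for all $m\in\mathbb{Z}^d$; $H=\Delta+Q$. Put $q_j=Q(v_j)$, $j=1,\ldots,\nu$, and let $q_1^\bullet\le\ldots\le q_\nu^\bullet$ be the numbers $q_1,\ldots,q_\nu$ in nondecreasing order. **Spectral bands.** Each unoriented edge yields two oriented edges of opposite directions (a loop also yields two). For $\vartheta\in\mathbb{T}^d=\mathbb{R}^d/(2\pi\mathbb{Z})^d$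 the Floquet matrix is the Hermitian $\nu\times\nu$ matrix $H(\vartheta)=\Delta(\vartheta)+\mathrm{diag}(q_1,\ldots,q_\nu)$ with $$\Delta_{jk}(\vartheta)=\varkappa_j\delta_{jk}-\sum e^{i\langle m,\vartheta\rangle},$$ the sum running over all oriented edges of $\Gamma$ starting at $v_j$ and ending at a vertex of the form $v_k+m$, $m\in\mathbb{Z}^d$ (an empty sum is $0$). $H$ is unitarily equivalent to the direct integral of the $H(\vartheta)$ over $\mathbb{T}^d$. Let $\lambda_1(\vartheta)\le\ldots\le\lambda_\nu(\vartheta)$ be the eigenvalues of $H(\vartheta)$ with multiplicity. The $n$-th spectral band is $\sigma_n(H)=\lambda_n(\mathbb{T}^d)=[\lambda_n^-,\lambda_n^+]$, $\lambda_n^-=\min_\vartheta\lambda_n(\vartheta)$, $\lambda_n^+=\max_\vartheta\lambda_n(\vartheta)$. **Finite graph $\Gamma_N$.** Let $\mathcal{E}_N^{in}$ be the set of edges of $\Gamma$ with both ends in $V_F$. A bridge is an edge of $\Gamma$ joining a vertex of $V_F$ with a vertex of $V\setminus V_F$; the set $\mathcal{B}$ of all bridges splits into pairs of bridges equivalent under $\mathbb{Z}^d$-translation. Let $\mathcal{B}_N$ be a set obtained by choosing one bridge from each pair. Then $\Gamma_N=(V_N,\mathcal{E}_N)$ with $\mathcal{E}_N=\mathcal{E}_N^{in}\cup\mathcal{B}_N$ and $V_N=V_F\cup\{u\in V:(u,v)_e\in\mathcal{B}_N,\ v\in V_F\}$. For $v\in V_N$, $\varkappa_v^N$ denotes the degree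 of $v$ in $\Gamma_N$ (loops counted twice) and $\rho_v=\#\big((\{v\}+\mathbb{Z}^d)\cap V_N\big)$. A vertex $v\in V_N$ is inner if $\varkappa_v^N=\varkappa_v$; $V_D$ is the set of inner vertices and $\partial V_N=V_N\setminus V_D$. Put $\nu_N=\#V_N$, $\nu_D=\#V_D$. Standing convention: the inner vertices lie in $V_F$ and are enumerated first, $V_D=\{v_1,\ldots,v_{\nu_D}\}\subset V_F$, and $\varkappa^N_{v_j}=\varkappa_j$, $\rho_{v_j}=1$ for $j\le\nu_D$. **Neumann and Dirichlet operators.** The Neumann operator on $\ell^2(V_N)$ is $H_N=\Delta_N+Q$ with $$(\Delta_Nf)(v)=\rho_v\varkappa_v^Nf(v)-\sqrt{\rho_v}\sum_{(v,u)_e\in\mathcal{E}_N}\sqrt{\rho_u}\,f(u),\qquad v\in V_N,$$ where the sum is over edges of $\Gamma_N$ at $v$ with multiplicity, a loop at $v$ contributing twice (consistently with the degree). The Dirichlet operator $H_D$ is $H_N$ with the conditions $f(v)=0$ for $v\in\partial V_N$, i.e. the compression of $H_N$ to $\ell^2(V_D)$ (the $\nu_D\times\nu_D$ principal submatrix of $H_N$ indexed by $V_D$). Their eigenvalues with multiplicity are $\lambda_1^N\le\ldots\le\lambda_{\nu_N}^N$ and $\lambda_1^D\le\ldots\le\lambda_{\nu_D}^D$ respectively. *)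

theory Defs
  imports
    "HOL-Analysis.Analysis"
    "HOL-Library.Uprod"
    "Jordan_Normal_Form.Char_Poly"
begin

text \<open>Both \<^theory>\<open>HOL-Analysis.Finite_Cartesian_Product\<close> and
  \<^theory>\<open>Jordan_Normal_Form.Matrix\<close> use the symbol \<open>$\<close> for components;
  below it is only ever used for the former.\<close>
no_notation Matrix.vec_index (infixl "$" 100)


subsection \<open>Unoriented multigraphs\<close>

text \<open>Edges are abstract objects, so multiple edges are allowed; \<open>Upair v v\<close> is a loop.\<close>

record ('v, 'e) mgraph =
  verts :: "'v set"
  edges :: "'e set"
  ends :: "'e \<Rightarrow> 'v uprod"

definition wf_mgraph :: "('v, 'e) mgraph \<Rightarrow> bool" where
  "wf_mgraph G \<longleftrightarrow> (\<forall>e\<in>edges G. set_uprod (ends G e) \<subseteq> verts G)"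

definition connected_mgraph :: "('v, 'e) mgraph \<Rightarrow> bool" where
  "connected_mgraph G \<longleftrightarrow> verts G \<noteq> {} \<and>
     (\<forall>u\<in>verts G. \<forall>v\<in>verts G. (u, v) \<in> {(x, y). \<exists>e\<in>edges G. ends G e = Upair x y}\<^sup>*)"

text \<open>The second summand makes loops count twice.\<close>

definition vdegree :: "('v, 'e) mgraph \<Rightarrow> 'v \<Rightarrow> nat" where
  "vdegree G v = card {e\<in>edges G. v \<in> set_uprod (ends G e)}
              + card {e\<in>edges G. ends G e = Upair v v}"

text \<open>The number of oriented edges from \<open>u\<close> to \<open>v\<close>.  Every unoriented edge yields two oriented
  edges of opposite directions; for a loop both of them lead from \<open>u\<close> to \<open>u\<close>.\<close>

definition oriented_edges :: "('v, 'e) mgraph \<Rightarrow> 'v \<Rightarrow> 'v \<Rightarrow> nat" where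
  "oriented_edges G u v = (if u = v then 2 else 1) * card {e\<in>edges G. ends G e = Upair u v}"


subsection \<open>Periodic graphs\<close>

text \<open>The lattice vector with integer coordinates \<open>m\<close> with respect to the basis \<open>a\<close>.\<close>

definition lattice_vec :: "('d::finite \<Rightarrow> real^'d) \<Rightarrow> int^'d \<Rightarrow> real^'d" where
  "lattice_vec a m = (\<Sum>s\<in>UNIV. of_int (m $ s) *\<^sub>R a s)"

definition is_basis :: "('d::finite \<Rightarrow> real^'d) \<Rightarrow> bool" where
  "is_basis a \<longleftrightarrow> inj a \<and> independent (range a) \<and> span (range a) = UNIV"

text \<open>Since edges are abstract, their translates are given by an action \<open>tr\<close> of the lattice on the
  edge set that is compatible with the translation of the end points.\<close>

definition periodic_graph ::
  "('d::finite \<Rightarrow> real^'d) \<Rightarrow> (real^'d, 'e) mgraph \<Rightarrow> (int^'d \<Rightarrow> 'e \<Rightarrow> 'e) \<Rightarrow> bool" where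
  "periodic_graph a G tr \<longleftrightarrow>
     wf_mgraph G \<and> connected_mgraph G \<and>
     (\<forall>S. bounded S \<longrightarrow> finite (verts G \<inter> S)) \<and>
     (\<forall>v\<in>verts G. finite {e\<in>edges G. v \<in> set_uprod (ends G e)}) \<and>
     is_basis a \<and>
     (\<forall>m. (\<lambda>v. v + lattice_vec a m) ` verts G = verts G) \<and>
     (\<forall>m. \<forall>e\<in>edges G. tr m e \<in> edges G \<and>
        ends G (tr m e) = map_uprod (\<lambda>v. v + lattice_vec a m) (ends G e)) \<and>
     (\<forall>e\<in>edges G. tr 0 e = e) \<and>
     (\<forall>m n. \<forall>e\<in>edges G. tr (m + n) e = tr m (tr n e))"

definition periodic_potential ::
  "('d::finite \<Rightarrow> real^'d) \<Rightarrow> (real^'d, 'e) mgraph \<Rightarrow> (real^'d \<Rightarrow> real) \<Rightarrow> bool" where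
  "periodic_potential a G Q \<longleftrightarrow> (\<forall>v\<in>verts G. \<forall>m. Q (v + lattice_vec a m) = Q v)"

definition max_degree :: "('v, 'e) mgraph \<Rightarrow> real" where
  "max_degree G = (SUP v\<in>verts G. real (vdegree G v))"

text \<open>The vertices in the fundamental cell \<open>[0,1)\<^sup>d\<close>, in coordinates with origin \<open>z\<close> and basis
  \<open>a\<close>.\<close>

definition cell_verts ::
  "('d::finite \<Rightarrow> real^'d) \<Rightarrow> real^'d \<Rightarrow> (real^'d, 'e) mgraph \<Rightarrow> (real^'d) set" where
  "cell_verts a z G =
     {z + (\<Sum>s\<in>UNIV. t s *\<^sub>R a s) | t. \<forall>s. 0 \<le> t s \<and> t s < 1} \<inter> verts G"


subsection \<open>Eigenvalues with multiplicity\<close>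

text \<open>The \<open>n\<close>-th smallest eigenvalue (\<open>n \<ge> 1\<close>) of a Hermitian matrix, counted with multiplicity;
  the roots of the characteristic polynomial are then real.\<close>

definition eigval :: "complex mat \<Rightarrow> nat \<Rightarrow> real" where
  "eigval A n = sorted_list_of_multiset (image_mset Re (proots (char_poly A))) ! (n - 1)"

text \<open>The matrix of an operator on functions, compressed to the span of the Kronecker deltas at the
  points of the list \<open>xs\<close>.\<close>

definition op_mat :: "'v list \<Rightarrow> (('v \<Rightarrow> complex) \<Rightarrow> 'v \<Rightarrow> complex) \<Rightarrow> complex mat" where
  "op_mat xs T = mat (length xs) (length xs)
     (\<lambda>(j, k). T (\<lambda>v. if v = xs ! k then 1 else 0) (xs ! j))"


subsection \<open>Floquet matrix and spectral bands\<close>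

text \<open>The list \<open>xs\<close> enumerates the vertices of the fundamental cell.  The sum over the oriented edges
  from \<open>v\<^sub>j\<close> to some \<open>v\<^sub>k + m\<close> is grouped by \<open>m\<close>; only finitely many \<open>m\<close> contribute.\<close>

definition floquet_mat ::
  "('d::finite \<Rightarrow> real^'d) \<Rightarrow> (real^'d, 'e) mgraph \<Rightarrow> (real^'d \<Rightarrow> real) \<Rightarrow>
   (real^'d) list \<Rightarrow> real^'d \<Rightarrow> complex mat" where
  "floquet_mat a G Q xs \<theta> = mat (length xs) (length xs) (\<lambda>(j, k).
     (if j = k then of_nat (vdegree G (xs ! j)) + of_real (Q (xs ! j)) else 0)
     - (\<Sum>m | oriented_edges G (xs ! j) (xs ! k + lattice_vec a m) \<noteq> 0.
          of_nat (oriented_edges G (xs ! j) (xs ! k + lattice_vec a m))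
          * exp (\<i> * of_real (\<Sum>s\<in>UNIV. of_int (m $ s) * \<theta> $ s))))"

text \<open>The quasimomentum runs through \<open>\<real>\<^sup>d\<close> instead of the torus; the Floquet matrix is
  \<open>2\<pi>\<close>-periodic in every coordinate of \<open>\<theta>\<close>.\<close>

definition spectral_band ::
  "('d::finite \<Rightarrow> real^'d) \<Rightarrow> (real^'d, 'e) mgraph \<Rightarrow> (real^'d \<Rightarrow> real) \<Rightarrow>
   (real^'d) list \<Rightarrow> nat \<Rightarrow> real set" where
  "spectral_band a G Q xs n = range (\<lambda>\<theta>. eigval (floquet_mat a G Q xs \<theta>) n)"


subsection \<open>The finite graph and its Neumann and Dirichlet operators\<close>

definition inner_edges :: "(real^'d) set \<Rightarrow> (real^'d, 'e) mgraph \<Rightarrow> 'e set" where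
  "inner_edges VF G = {e\<in>edges G. set_uprod (ends G e) \<subseteq> VF}"

definition bridges :: "(real^'d) set \<Rightarrow> (real^'d, 'e) mgraph \<Rightarrow> 'e set" where
  "bridges VF G = {e\<in>edges G. \<exists>u\<in>VF. \<exists>w\<in>verts G - VF. ends G e = Upair u w}"

text \<open>The classes of bridges under translation are pairs, and \<open>BN\<close> contains exactly one bridge of
  each class.\<close>

definition bridge_choice ::
  "(real^'d::finite) set \<Rightarrow> (real^'d, 'e) mgraph \<Rightarrow> (int^'d \<Rightarrow> 'e \<Rightarrow> 'e) \<Rightarrow> 'e set \<Rightarrow> bool" where
  "bridge_choice VF G tr BN \<longleftrightarrow>
     BN \<subseteq> bridges VF G \<and> (\<forall>e\<in>bridges VF G. \<exists>!e'. e' \<in> BN \<and> (\<exists>m. e' = tr m e))"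

definition finite_graph ::
  "(real^'d) set \<Rightarrow> (real^'d, 'e) mgraph \<Rightarrow> 'e set \<Rightarrow> (real^'d, 'e) mgraph" where
  "finite_graph VF G BN =
     \<lparr>verts = VF \<union> {u\<in>verts G. \<exists>e\<in>BN. \<exists>v\<in>VF. ends G e = Upair u v},
      edges = inner_edges VF G \<union> BN,
      ends = ends G\<rparr>"

definition inner_verts :: "('v, 'e) mgraph \<Rightarrow> ('v, 'e) mgraph \<Rightarrow> 'v set" where
  "inner_verts G GN = {v\<in>verts GN. vdegree GN v = vdegree G v}"

definition rho ::
  "('d::finite \<Rightarrow> real^'d) \<Rightarrow> (real^'d, 'e) mgraph \<Rightarrow> real^'d \<Rightarrow> nat" where
  "rho a GN v = card (range (\<lambda>m. v + lattice_vec a m) \<inter> verts GN)"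

text \<open>The sum over the edges of \<open>GN\<close> at \<open>v\<close> is grouped by the other end \<open>u\<close>; a loop at \<open>v\<close> occurs
  twice.\<close>

definition neumann_op ::
  "('d::finite \<Rightarrow> real^'d) \<Rightarrow> (real^'d, 'e) mgraph \<Rightarrow> (real^'d \<Rightarrow> real) \<Rightarrow>
   (real^'d \<Rightarrow> complex) \<Rightarrow> real^'d \<Rightarrow> complex" where
  "neumann_op a GN Q f v =
     of_nat (rho a GN v * vdegree GN v) * f v
     - of_real (sqrt (rho a GN v)) *
         (\<Sum>u\<in>verts GN. of_nat (oriented_edges GN v u) * of_real (sqrt (rho a GN u)) * f u)
     + of_real (Q v) * f v"

end

theory Submission
  imports Defs "Jordan_Normal_Form.Schur_Decomposition"
begin

text \<open>The quasi-periodic extension of a vector on the fundamental cell with quasimomentum \<open>\<theta>\<close>,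
  restricted to the finite graph and divided by \<open>\<surd>\<rho>\<close>, is an isometry that carries the quadratic form
  of the Floquet matrix to that of the Neumann operator: every translation class of edges meeting the
  cell has exactly one member in the finite graph, so both forms are the same sum over edges.  An
  inner vertex is the only point of its lattice orbit in the finite graph, so the Dirichlet operator
  is in turn a compression of the Floquet matrix to the inner vertices.  Both pairs of spectral bounds
  are then Cauchy interlacing.  The bounds by \<open>q\<close> compare the Floquet matrix with
  the diagonal matrices \<open>Q\<close> and \<open>Q + 2\<kappa>\<^sub>+\<close>, since the edge part of the form lies
  between 0 and \<open>2\<kappa>\<^sub>+\<close>.\<close>

no_notation Matrix.vec_index (infixl "$" 100)


subsection \<open>Hermitian matrices and interlacing\<close>

text \<open>The entries of the Floquet and Neumann matrices cannot be matched vertex by vertex: the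
  edges at a cell vertex are distributed over its \<open>rho\<close> copies in the finite graph, so
  a single copy may see only part of the degree. Only the total forms agree, after both have been
  regrouped by edges. The weights in the Neumann operator fit this: the factors \<open>rho\<close>
  and the roots of \<open>rho\<close> cancel in the edge part against the division by the root of
  \<open>rho\<close>, and the remaining weight \<open>1 / rho\<close> averages the norm and the
  potential over the copies. Eigenvalues are defined as sorted roots of a characteristic polynomial.
  Comparing them therefore needs a unitary diagonalisation whose diagonal appears in increasing
  order; a dimension count among the eigenvectors then takes the place of a min-max formula over
  subspaces. The constant 2 in the upper bound comes from
  \<open>|s - t|^2 <= 2 |s|^2 + 2 |t|^2\<close>: each edge charges each of its ends 2, and a vertex
  is charged as often as its degree.\<close>

lemma dim_mat_adjoint [simp]:
  "dim_row (mat_adjoint A) = dim_col A" "dim_col (mat_adjoint A) = dim_row A"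
  by (simp_all add: mat_adjoint_def)

lemma index_mat_adjoint [simp]:
  "i < dim_col A \<Longrightarrow> j < dim_row A \<Longrightarrow> mat_adjoint A $$ (i, j) = conjugate (A $$ (j, i))"
  by (simp add: mat_adjoint_def mat_of_rows_def)

lemma mat_adjoint_carrier [simp]: "A \<in> carrier_mat n m \<Longrightarrow> mat_adjoint A \<in> carrier_mat m n"
  by (auto intro!: carrier_matI)

lemma mat_adjoint_mult:
  fixes A B :: "complex mat"
  assumes "A \<in> carrier_mat n m" "B \<in> carrier_mat m k"
  shows "mat_adjoint (A * B) = mat_adjoint B * mat_adjoint A"
  using assms by (intro eq_matI) (auto simp: scalar_prod_def mult.commute intro!: sum.cong)

lemma mat_adjoint_adjoint [simp]:
  fixes A :: "complex mat"
  shows "mat_adjoint (mat_adjoint A) = A"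
  by (intro eq_matI) auto

section \<open>Unitary diagonalisation of Hermitian matrices\<close>

definition hermitian_mat :: "complex mat \<Rightarrow> bool" where
  "hermitian_mat A \<longleftrightarrow> mat_adjoint A = A"

lemma hermitian_mat_carrierI:
  assumes "A \<in> carrier_mat n n" "\<And>i j. i < n \<Longrightarrow> j < n \<Longrightarrow> A $$ (i, j) = cnj (A $$ (j, i))"
  shows "hermitian_mat A"
  unfolding hermitian_mat_def
proof (rule eq_matI)
  fix i j assume "i < dim_row A" "j < dim_col A"
  thus "mat_adjoint A $$ (i, j) = A $$ (i, j)" using assms by (simp flip: assms(2))
qed (use assms(1) in auto)

lemma hermitian_mat_congruence:
  assumes "A \<in> carrier_mat n n" "hermitian_mat A" "W \<in> carrier_mat n m"
  shows "hermitian_mat (mat_adjoint W * A * W)"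
proof -
  have "mat_adjoint (mat_adjoint W * A * W) = mat_adjoint W * mat_adjoint (mat_adjoint W * A)"
    using assms by (intro mat_adjoint_mult[of _ m n]) auto
  also have "mat_adjoint (mat_adjoint W * A) = mat_adjoint A * W"
    using assms by (subst mat_adjoint_mult[of _ m n]) auto
  also have "mat_adjoint W * (mat_adjoint A * W) = mat_adjoint W * A * W"
    using assms by (subst assoc_mult_mat[of _ m n _ n _ m]) (auto simp: hermitian_mat_def)
  finally show ?thesis by (simp add: hermitian_mat_def)
qed

text \<open>Complete an eigenvector to a basis, orthogonalise and normalise. Unit length of the
  columns is what makes the inverse equal to the adjoint, and conjugation by such a \<open>W\<close>
  keeps a matrix Hermitian.\<close>

lemma unitary_with_eigenvector:
  fixes A :: "complex mat"
  assumes A: "A \<in> carrier_mat n n" and e: "eigenvalue A e"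
  shows "\<exists>W\<in>carrier_mat n n. mat_adjoint W * W = 1\<^sub>m n \<and>
           col (mat_adjoint W * A * W) 0 = vec n (\<lambda>i. if i = 0 then e else 0)"
proof -
  obtain v where "eigenvector A v e" using e by (auto simp: eigenvalue_def)
  hence v: "v \<in> carrier_vec n" "v \<noteq> 0\<^sub>v n" "A *\<^sub>v v = e \<cdot>\<^sub>v v"
    using A by (auto simp: eigenvector_def)
  have n: "n \<noteq> 0" using v by (metis carrier_vecD eq_vecI index_zero_vec(2) less_zeroE)
  interpret cof_vec_space n "TYPE(complex)" .
  define b where "b = basis_completion v"
  define ws where "ws = gram_schmidt n b"
  from basis_completion[OF v(1,2), folded b_def]
  have dist_b: "distinct b" and indep: "\<not> lin_dep (set b)" and b: "set b \<subseteq> carrier_vec n"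
    and hdb: "hd b = v" and len_b: "length b = n" by auto
  from hdb len_b n obtain vs where bv: "b = v # vs" by (cases b) auto
  from gram_schmidt_result[OF b dist_b indep refl, folded ws_def]
  have ws: "set ws \<subseteq> carrier_vec n" "corthogonal ws" "length ws = n" by (auto simp: len_b)
  have hdws: "hd ws = v" using gram_schmidt_hd[OF v(1), of vs, folded bv] unfolding ws_def .
  \<comment> \<open>The reciprocal of the norm. The inner product is complex-valued;
    \<open>pos\<close> confirms that it is a positive real on the vectors used.\<close>
  define c :: "complex vec \<Rightarrow> complex" where "c w = of_real (1 / sqrt (Re (w \<bullet>c w)))" for w
  define us where "us = map (\<lambda>w. c w \<cdot>\<^sub>v w) ws"
  have wsi: "ws ! i \<in> carrier_vec n" if "i < n" for i using ws that by auto
  have pos: "ws ! i \<bullet>c ws ! i = of_real (Re (ws ! i \<bullet>c ws ! i))" "Re (ws ! i \<bullet>c ws ! i) > 0"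
    if "i < n" for i
  proof -
    have "ws ! i \<bullet>c ws ! i \<noteq> 0" using corthogonalD[OF ws(2)] that ws(3) by auto
    moreover have "ws ! i \<bullet>c ws ! i \<ge> 0" by (rule conjugate_square_ge_0_vec)
    ultimately show "ws ! i \<bullet>c ws ! i = of_real (Re (ws ! i \<bullet>c ws ! i))"
      "Re (ws ! i \<bullet>c ws ! i) > 0"
      by (auto simp: complex_eq_iff less_eq_complex_def)
  qed
  have us_us: "us ! i \<bullet>c us ! j = (if i = j then 1 else 0)" if "i < n" "j < n" for i j
  proof -
    have "us ! i \<bullet>c us ! j = c (ws ! i) * (cnj (c (ws ! j)) * (ws ! i \<bullet>c ws ! j))"
      using that ws wsi[OF that(1)] wsi[OF that(2)]
      by (simp add: us_def conjugate_smult_vec)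
    also have "\<dots> = (if i = j then 1 else 0)"
    proof (cases "i = j")
      case True
      define r where "r = Re (ws ! i \<bullet>c ws ! i)"
      have r: "r > 0" "ws ! i \<bullet>c ws ! i = of_real r" "c (ws ! i) = of_real (1 / sqrt r)"
        using pos[OF that(1)] by (auto simp: r_def c_def)
      have "c (ws ! i) * (cnj (c (ws ! i)) * (ws ! i \<bullet>c ws ! i)) =
          of_real (1 / sqrt r * (1 / sqrt r * r))"
        unfolding r(2,3) by (simp only: complex_cnj_complex_of_real of_real_mult)
      also have "1 / sqrt r * (1 / sqrt r * r) = 1" using r(1) by simp
      finally have "c (ws ! i) * (cnj (c (ws ! i)) * (ws ! i \<bullet>c ws ! i)) = 1" by simp
      thus ?thesis using True by simp
    next
      case False
      thus ?thesis using corthogonalD[OF ws(2)] that ws(3) by auto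
    qed
    finally show ?thesis .
  qed
  have us: "set us \<subseteq> carrier_vec n" "length us = n"
    using ws by (auto simp: us_def)
  have orth_us: "corthogonal us"
    by (rule corthogonalI) (simp add: us_us us(2))
  have hd_us: "hd us = c v \<cdot>\<^sub>v v" using hdws ws(3) n by (cases ws) (auto simp: us_def)
  have cv: "c v \<noteq> 0"
  proof -
    have "v = ws ! 0" using hdws ws(3) n by (cases ws) auto
    thus ?thesis using pos(2)[of 0] n by (auto simp: c_def)
  qed
  define W where "W = mat_of_cols n us"
  have W: "W \<in> carrier_mat n n" using us by (auto simp: W_def)
  \<comment> \<open>\<open>corthogonal_inv\<close> divides each conjugated column by its squared
    norm, which is 1 here.\<close>
  have adj: "corthogonal_inv W = mat_adjoint W"
  proof -
    have "map vec_inv us = map conjugate us"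
      using us_us us(2) by (auto simp: vec_inv_def in_set_conv_nth)
    thus ?thesis unfolding corthogonal_inv_def mat_adjoint_def W_def
      by (simp only: cols_mat_of_cols[OF us(1)])
  qed
  have "mat_adjoint W * W = 1\<^sub>m n"
    using corthogonal_inv_result[OF orthogonal_mat_of_cols[OF us(1) orth_us us(2)]] W
    by (simp add: inverts_mat_def adj flip: W_def)
  moreover have "col (mat_adjoint W * A * W) 0 = vec n (\<lambda>i. if i = 0 then e else 0)"
    unfolding adj[symmetric] unfolding W_def
  proof (rule corthogonal_col_ev_0[OF A _ _ _ n hd_us us(1) orth_us us(2)])
    have "v = (1 / c v) \<cdot>\<^sub>v (c v \<cdot>\<^sub>v v)" using cv by (simp add: smult_smult_assoc)
    thus "c v \<cdot>\<^sub>v v \<noteq> 0\<^sub>v n" using v(2) by auto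
    show "A *\<^sub>v (c v \<cdot>\<^sub>v v) = e \<cdot>\<^sub>v (c v \<cdot>\<^sub>v v)"
      using v A by (simp add: mult_mat_vec smult_smult_assoc mult.commute)
  qed (use v in auto)
  ultimately show ?thesis using W by blast
qed

text \<open>Deflation: each step splits off the head of \<open>es\<close>. The characteristic
  polynomial determines \<open>es\<close> only up to order, so the order of the diagonal can be
  chosen freely when the theorem is applied.\<close>

theorem hermitian_unitary_diagonalization:
  fixes A :: "complex mat"
  assumes "A \<in> carrier_mat n n" "hermitian_mat A" "char_poly A = (\<Prod>e\<leftarrow>es. [:- e, 1:])"
  shows "\<exists>U\<in>carrier_mat n n. mat_adjoint U * U = 1\<^sub>m n \<and>
           mat_adjoint U * A * U = mat n n (\<lambda>(i, j). if i = j then es ! i else 0)"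
  using assms
proof (induction es arbitrary: n A)
  case Nil
  hence "n = 0" using degree_monic_char_poly[of A n] by auto
  thus ?case using Nil by (intro bexI[of _ "1\<^sub>m 0"]) auto
next
  case (Cons e es n A)
  note A = Cons.prems(1)
  have cp: "char_poly A = [:-e, 1:] * (\<Prod>e\<leftarrow>es. [:- e, 1:])" using Cons.prems by simp
  have mon: "monic (\<Prod>e\<leftarrow>es. [:- e, 1:])" by (rule monic_prod_list) auto
  have "degree (char_poly A) = Suc (degree (\<Prod>e\<leftarrow>es. [:- e, 1:]))" unfolding cp
    by (subst degree_mult_eq) (use mon in auto)
  with degree_monic_char_poly[OF A] obtain m where n: "n = Suc m" by metis
  have "eigenvalue A e" using A cp by (simp add: eigenvalue_root_char_poly)
  then obtain W where W: "W \<in> carrier_mat n n" "mat_adjoint W * W = 1\<^sub>m n"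
    and col: "col (mat_adjoint W * A * W) 0 = vec n (\<lambda>i. if i = 0 then e else 0)"
    using unitary_with_eigenvector[OF A] by blast
  define W' where "W' = mat_adjoint W"
  have W': "W' \<in> carrier_mat n n" using W by (simp add: W'_def)
  have WW': "W * W' = 1\<^sub>m n" using mat_mult_left_right_inverse[OF W' W(1)] W(2) by (simp add: W'_def)
  define B where "B = W' * A * W"
  have B: "B \<in> carrier_mat n n" using W W' A by (auto simp: B_def)
  have hB: "hermitian_mat B"
    unfolding B_def W'_def by (rule hermitian_mat_congruence) (use Cons.prems W in auto)
  have B0: "B $$ (i, 0) = (if i = 0 then e else 0)" if "i < n" for i
    using arg_cong[OF col[folded W'_def, folded B_def], of "\<lambda>v. vec_index v i"] that n carrier_matD[OF B]
    by simp
  \<comment> \<open>Hermitian symmetry carries the shape of the first column over to the first row,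
    so \<open>B\<close> splits into blocks of sizes 1 and \<open>m\<close>.\<close>
  have B0': "B $$ (0, i) = (if i = 0 then e else 0)" if "i < n" for i
  proof -
    have "B $$ (0, i) = mat_adjoint B $$ (0, i)" using hB by (simp add: hermitian_mat_def)
    also have "\<dots> = cnj (B $$ (i, 0))" using B that n by auto
    finally have *: "B $$ (0, i) = cnj (B $$ (i, 0))" .
    show ?thesis using * B0[OF that] B0[of 0] n by (cases "i = 0") auto
  qed
  define E where "E = mat 1 1 (\<lambda>_. e)"
  define C where "C = mat m m (\<lambda>(i, j). B $$ (Suc i, Suc j))"
  have E: "E \<in> carrier_mat 1 1" and C: "C \<in> carrier_mat m m" by (auto simp: E_def C_def)
  have Bblock: "B = four_block_mat E (0\<^sub>m 1 m) (0\<^sub>m m 1) C"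
    using B B0 B0' n by (intro eq_matI) (auto simp: E_def C_def)
  have hC: "hermitian_mat C"
  proof (rule hermitian_mat_carrierI[OF C])
    fix i j assume "i < m" "j < m"
    thus "C $$ (i, j) = cnj (C $$ (j, i))"
      using arg_cong[OF hB[unfolded hermitian_mat_def], of "\<lambda>B. B $$ (Suc i, Suc j)"] B n
      by (simp add: C_def)
  qed
  have "similar_mat B A"
    unfolding similar_mat_def
    by (intro exI, rule similar_mat_witI[of W' W n])
       (use W W' WW' A B in \<open>auto simp: B_def W'_def\<close>)
  hence "char_poly B = char_poly A" by (rule char_poly_similar)
  moreover have "char_poly B = char_poly E * char_poly C"
    unfolding Bblock by (rule char_poly_four_block_zeros_col[OF E _ C]) auto
  moreover have "char_poly E = [:-e, 1:]"
    by (simp add: E_def char_poly_defs det_def sign_def)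
  \<comment> \<open>Cancelling the factor of the split-off eigenvalue leaves exactly the hypothesis
    of the induction for the tail.\<close>
  ultimately have "char_poly C = (\<Prod>e\<leftarrow>es. [:- e, 1:])"
    using cp by (metis mult_cancel_left pCons_eq_0_iff zero_neq_one)
  from Cons.IH[OF C hC this] obtain U where U: "U \<in> carrier_mat m m" "mat_adjoint U * U = 1\<^sub>m m"
    and UCU: "mat_adjoint U * C * U = mat m m (\<lambda>(i, j). if i = j then es ! i else 0)" by blast
  \<comment> \<open>The identity on the first coordinate leaves the eigenvalue already split off
    untouched; \<open>W * X\<close> is the unitary sought.\<close>
  define X where "X = four_block_mat (1\<^sub>m 1) (0\<^sub>m 1 m) (0\<^sub>m m 1) U"
  have X: "X \<in> carrier_mat n n" using U n by (auto simp: X_def)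
  have aX: "mat_adjoint X = four_block_mat (1\<^sub>m 1) (0\<^sub>m 1 m) (0\<^sub>m m 1) (mat_adjoint U)"
    using U by (intro eq_matI) (auto simp: X_def)
  have XX: "mat_adjoint X * X = 1\<^sub>m n"
    unfolding aX unfolding X_def
    by (subst mult_four_block_mat[where ?n1.0 = 1 and ?n2.0 = m and ?nr1.0 = 1 and ?nr2.0 = m
          and ?nc1.0 = 1 and ?nc2.0 = m])
       (use U n in \<open>auto intro!: eq_matI\<close>)
  have XBX: "mat_adjoint X * B * X = mat n n (\<lambda>(i, j). if i = j then (e # es) ! i else 0)"
  proof -
    have "mat_adjoint X * B = four_block_mat E (0\<^sub>m 1 m) (0\<^sub>m m 1) (mat_adjoint U * C)"
      unfolding aX Bblock
      by (subst mult_four_block_mat[where ?n1.0 = 1 and ?n2.0 = m and ?nr1.0 = 1 and ?nr2.0 = m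
            and ?nc1.0 = 1 and ?nc2.0 = m]) (use U E C in auto)
    hence "mat_adjoint X * B * X = four_block_mat E (0\<^sub>m 1 m) (0\<^sub>m m 1) (mat_adjoint U * C * U)"
      unfolding X_def
      by simp (subst mult_four_block_mat[where ?n1.0 = 1 and ?n2.0 = m and ?nr1.0 = 1 and ?nr2.0 = m
            and ?nc1.0 = 1 and ?nc2.0 = m], use U E C in auto)
    thus ?thesis unfolding UCU by simp (rule eq_matI, auto simp: E_def n nth_Cons split: nat.splits)
  qed
  have "mat_adjoint (W * X) = mat_adjoint X * W'"
    unfolding W'_def by (rule mat_adjoint_mult) (use W X in auto)
  moreover have "mat_adjoint X * W' * (W * X) = mat_adjoint X * X"
  proof -
    have "mat_adjoint X * W' * (W * X) = mat_adjoint X * (W' * (W * X))"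
      by (rule assoc_mult_mat) (use W W' X in auto)
    also have "W' * (W * X) = W' * W * X" by (rule assoc_mult_mat[symmetric]) (use W W' X in auto)
    finally show ?thesis using W X by (simp add: W'_def)
  qed
  moreover have "mat_adjoint X * W' * A * (W * X) = mat_adjoint X * B * X"
  proof -
    have "mat_adjoint X * W' * A * W = mat_adjoint X * (W' * A) * W"
      using W W' X A by (simp add: assoc_mult_mat[of _ n n _ n _ n])
    also have "\<dots> = mat_adjoint X * B"
      unfolding B_def by (rule assoc_mult_mat) (use W W' X A in auto)
    finally have *: "mat_adjoint X * W' * A * W = mat_adjoint X * B" .
    have "mat_adjoint X * W' * A * (W * X) = mat_adjoint X * W' * A * W * X"
      by (rule assoc_mult_mat[symmetric]) (use W W' X A in auto)
    also have "\<dots> = mat_adjoint X * B * X" by (simp only: *)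
    finally show ?thesis .
  qed
  ultimately show ?case using W X XX XBX by (intro bexI[of _ "W * X"]) auto
qed


section \<open>Ordered eigenvalues from the characteristic polynomial\<close>

lemma prod_list_linear_proots:
  fixes as :: "complex list"
  shows "proots (\<Prod>a\<leftarrow>as. [:- a, 1:]) = mset as"
proof (induction as)
  case (Cons a as)
  have "(\<Prod>a\<leftarrow>as. [:- a, 1:]) \<noteq> 0" by (auto simp: prod_list_zero_iff)
  hence "proots ([:- a, 1:] * (\<Prod>a\<leftarrow>as. [:- a, 1:])) = proots [:- a, 1:] + mset as"
    unfolding Cons.IH[symmetric] by (intro proots_mult) auto
  thus ?case by (simp del: mult_pCons_left)
qed auto

lemma eigval_of_char_poly:
  assumes "char_poly A = (\<Prod>a\<leftarrow>as. [:- a, 1:])"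
  shows "eigval A k = sort (map Re as) ! (k - 1)"
  unfolding eigval_def assms prod_list_linear_proots
  by (simp flip: mset_map)

lemma eigval_diagonal:
  "eigval (mat n n (\<lambda>(i, j). if i = j then complex_of_real (f i) else 0)) k =
     sort (map f [0..<n]) ! (k - 1)" (is "eigval ?D k = _")
proof -
  have "char_poly ?D = (\<Prod>a\<leftarrow>diag_mat ?D. [:- a, 1:])"
    by (rule char_poly_upper_triangular[of _ n]) (auto simp: upper_triangular_def)
  moreover have "map Re (diag_mat ?D) = map f [0..<n]" by (auto simp: diag_mat_def)
  ultimately show ?thesis using eigval_of_char_poly[of ?D "diag_mat ?D" k] by (simp only:)
qed

text \<open>The matrix is diagonalised twice. The first time, with the roots in any order, shows
  that they are real, being diagonal entries of a Hermitian matrix. Only then may the list be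
  replaced by its sorted real parts, and the second diagonalisation has \<open>eigval\<close> on the
  diagonal.\<close>

lemma hermitian_eigval:
  assumes A: "A \<in> carrier_mat n n" and h: "hermitian_mat A"
  shows "\<exists>U\<in>carrier_mat n n. mat_adjoint U * U = 1\<^sub>m n \<and> mat_adjoint U * A * U =
           mat n n (\<lambda>(i, j). if i = j then complex_of_real (eigval A (Suc i)) else 0)"
    and "i \<le> j \<Longrightarrow> j < n \<Longrightarrow> eigval A (Suc i) \<le> eigval A (Suc j)"
proof -
  obtain as where as: "char_poly A = (\<Prod>a\<leftarrow>as. [:- a, 1:])" "length as = n"
    using char_poly_factorized[OF A] by blast
  obtain U where U: "U \<in> carrier_mat n n" and
    D: "mat_adjoint U * A * U = mat n n (\<lambda>(i, j). if i = j then as ! i else 0)"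
    using hermitian_unitary_diagonalization[OF A h as(1)] by blast
  have real: "complex_of_real (Re (as ! i)) = as ! i" if "i < n" for i
  proof -
    have "hermitian_mat (mat_adjoint U * A * U)" by (rule hermitian_mat_congruence[OF A h U])
    from arg_cong[OF this[unfolded hermitian_mat_def D], of "\<lambda>B. B $$ (i, i)"]
    show ?thesis using that by (simp add: complex_eq_iff)
  qed
  define rs where "rs = sort (map Re as)"
  have ev: "eigval A (Suc i) = rs ! i" for i
    using eigval_of_char_poly[OF as(1), of "Suc i"] by (simp add: rs_def)
  have "map (\<lambda>a. complex_of_real (Re a)) as = as"
    using real as(2) by (intro nth_equalityI) auto
  moreover have "mset (map complex_of_real rs) = mset (map (\<lambda>a. complex_of_real (Re a)) as)"
    by (simp add: rs_def multiset.map_comp o_def)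
  ultimately have "mset (map complex_of_real rs) = mset as" by (simp only:)
  hence "mset (map (\<lambda>a. [:- a, 1:]) (map complex_of_real rs)) = mset (map (\<lambda>a. [:- a, 1:]) as)"
    by (simp only: mset_map)
  hence "char_poly A = (\<Prod>a\<leftarrow>map complex_of_real rs. [:- a, 1:])"
    unfolding as(1) by (metis prod_mset_prod_list)
  from hermitian_unitary_diagonalization[OF A h this] obtain V where
    V: "V \<in> carrier_mat n n" "mat_adjoint V * V = 1\<^sub>m n" and
    D: "mat_adjoint V * A * V = mat n n (\<lambda>(i, j). if i = j then map complex_of_real rs ! i else 0)"
    by blast
  have len: "length rs = n" using as by (simp add: rs_def)
  have "mat_adjoint V * A * V =
      mat n n (\<lambda>(i, j). if i = j then complex_of_real (eigval A (Suc i)) else 0)"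
    unfolding D ev by (intro eq_matI) (auto simp: len)
  thus "\<exists>U\<in>carrier_mat n n. mat_adjoint U * U = 1\<^sub>m n \<and> mat_adjoint U * A * U =
      mat n n (\<lambda>(i, j). if i = j then complex_of_real (eigval A (Suc i)) else 0)"
    using V by blast
  show "i \<le> j \<Longrightarrow> j < n \<Longrightarrow> eigval A (Suc i) \<le> eigval A (Suc j)"
    unfolding ev using len by (intro sorted_nth_mono) (auto simp: rs_def)
qed

section \<open>Quadratic forms and the comparison of eigenvalues\<close>

definition hform :: "complex mat \<Rightarrow> (nat \<Rightarrow> complex) \<Rightarrow> real" where
  "hform A x = Re (\<Sum>i<dim_row A. \<Sum>j<dim_row A. cnj (x i) * A $$ (i, j) * x j)"

lemma hform_cong:
  assumes "A \<in> carrier_mat n n" "\<And>i. i < n \<Longrightarrow> x i = y i"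
  shows "hform A x = hform A y"
  using assms by (auto simp: hform_def intro!: sum.cong arg_cong[of _ _ Re])

text \<open>Serves twice in the next lemma: with a matrix for the quadratic form, and with the
  Kronecker delta for the norm.\<close>

lemma sesquilinear_sum_expand:
  fixes A :: "'i \<Rightarrow> 'j \<Rightarrow> 'a::comm_semiring_1"
  shows "(\<Sum>i\<in>I. \<Sum>j\<in>J. (\<Sum>l\<in>L. a l * p l i) * A i j * (\<Sum>m\<in>M. b m * q m j)) =
    (\<Sum>l\<in>L. \<Sum>m\<in>M. a l * b m * (\<Sum>i\<in>I. \<Sum>j\<in>J. p l i * A i j * q m j))"
proof -
  define t where "t = (\<lambda>(i, j) (l, m). a l * p l i * A i j * (b m * q m j))"
  have "(\<Sum>l\<in>L. a l * p l i) * A i j * (\<Sum>m\<in>M. b m * q m j) =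
      (\<Sum>l\<in>L. \<Sum>m\<in>M. t (i, j) (l, m))" for i j
    by (subst sum.swap) (simp add: t_def sum_distrib_left sum_distrib_right)
  hence "(\<Sum>i\<in>I. \<Sum>j\<in>J. (\<Sum>l\<in>L. a l * p l i) * A i j * (\<Sum>m\<in>M. b m * q m j)) =
      (\<Sum>x\<in>I \<times> J. \<Sum>y\<in>L \<times> M. t x y)"
    by (simp add: sum.cartesian_product')
  also have "\<dots> = (\<Sum>y\<in>L \<times> M. \<Sum>x\<in>I \<times> J. t x y)" by (rule sum.swap)
  also have "\<dots> = (\<Sum>l\<in>L. \<Sum>m\<in>M. a l * b m * (\<Sum>i\<in>I. \<Sum>j\<in>J. p l i * A i j * q m j))"
    by (simp add: sum.cartesian_product' t_def sum_distrib_left mult_ac)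
  finally show ?thesis .
qed

text \<open>The columns of the diagonalising unitary \<open>U\<close>, in coordinates. The norm
  identity is \<open>U* U = 1\<close>; the expansion of an arbitrary \<open>x\<close> is
  \<open>U U* = 1\<close>.\<close>

lemma hermitian_eigenbasis:
  assumes A: "A \<in> carrier_mat n n" and h: "hermitian_mat A"
  obtains u :: "nat \<Rightarrow> nat \<Rightarrow> complex" where
    "\<And>c. hform A (\<lambda>i. \<Sum>l<n. c l * u l i) = (\<Sum>l<n. eigval A (Suc l) * (cmod (c l))\<^sup>2)"
    "\<And>c. (\<Sum>i<n. (cmod (\<Sum>l<n. c l * u l i))\<^sup>2) = (\<Sum>l<n. (cmod (c l))\<^sup>2)"
    "\<And>x i. i < n \<Longrightarrow> (\<Sum>l<n. (\<Sum>k<n. cnj (u l k) * x k) * u l i) = x i"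
proof -
  obtain U where U: "U \<in> carrier_mat n n" "mat_adjoint U * U = 1\<^sub>m n" and
    D: "mat_adjoint U * A * U =
      mat n n (\<lambda>(i, j). if i = j then complex_of_real (eigval A (Suc i)) else 0)"
    using hermitian_eigval(1)[OF A h] by blast
  have UU: "U * mat_adjoint U = 1\<^sub>m n"
    by (rule mat_mult_left_right_inverse[OF _ U(1) U(2)]) (use U in simp)
  define u where "u l i = U $$ (i, l)" for l i
  have O1: "(\<Sum>i<n. cnj (u l i) * u m i) = (if l = m then 1 else 0)" if "l < n" "m < n" for l m
    using arg_cong[OF U(2), of "\<lambda>B. B $$ (l, m)"] that U(1)
    by (simp add: scalar_prod_def u_def atLeast0LessThan)
  have O2: "(\<Sum>l<n. u l i * cnj (u l k)) = (if i = k then 1 else 0)" if "i < n" "k < n" for i k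
    using arg_cong[OF UU, of "\<lambda>B. B $$ (i, k)"] that U(1)
    by (simp add: scalar_prod_def u_def atLeast0LessThan)
  have E: "(\<Sum>i<n. \<Sum>j<n. cnj (u l i) * A $$ (i, j) * u m j) =
      (if l = m then complex_of_real (eigval A (Suc l)) else 0)" if "l < n" "m < n" for l m
  proof -
    have "(\<Sum>j<n. (\<Sum>i<n. cnj (u l i) * A $$ (i, j)) * u m j) =
        (if l = m then complex_of_real (eigval A (Suc l)) else 0)"
      using arg_cong[OF D, of "\<lambda>B. B $$ (l, m)"] that U(1) A
      by (simp add: scalar_prod_def u_def atLeast0LessThan)
    thus ?thesis by (subst sum.swap) (simp add: sum_distrib_right)
  qed
  have nsq: "(complex_of_real (cmod w))\<^sup>2 = w * cnj w" for w
    using complex_norm_square[of w] by simp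
  have diag: "(\<Sum>l<n. \<Sum>m<n. cnj (c l) * c m * (if l = m then complex_of_real (f l) else 0)) =
      complex_of_real (\<Sum>l<n. f l * (cmod (c l))\<^sup>2)" for c f
    by (simp add: if_distrib sum.delta nsq mult_ac cong: if_cong)
  show ?thesis
  proof (rule that[of u])
    fix c
    have "(\<Sum>i<n. \<Sum>j<n. cnj (\<Sum>l<n. c l * u l i) * A $$ (i, j) * (\<Sum>l<n. c l * u l j)) =
        (\<Sum>l<n. \<Sum>m<n. cnj (c l) * c m * (\<Sum>i<n. \<Sum>j<n. cnj (u l i) * A $$ (i, j) * u m j))"
      unfolding cnj_sum complex_cnj_mult by (rule sesquilinear_sum_expand)
    also have "\<dots> = complex_of_real (\<Sum>l<n. eigval A (Suc l) * (cmod (c l))\<^sup>2)"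
      by (subst diag[symmetric]) (simp add: E)
    finally show "hform A (\<lambda>i. \<Sum>l<n. c l * u l i) = (\<Sum>l<n. eigval A (Suc l) * (cmod (c l))\<^sup>2)"
      using A by (simp add: hform_def)
    have "complex_of_real (\<Sum>i<n. (cmod (\<Sum>l<n. c l * u l i))\<^sup>2) =
        (\<Sum>i<n. \<Sum>j<n. cnj (\<Sum>l<n. c l * u l i) * (if i = j then 1 else 0) * (\<Sum>l<n. c l * u l j))"
      by (simp add: if_distrib if_distribR sum.delta nsq mult_ac del: cnj_sum cong: if_cong)
    also have "\<dots> = (\<Sum>l<n. \<Sum>m<n. cnj (c l) * c m * (\<Sum>i<n. \<Sum>j<n. cnj (u l i) * (if i = j then 1 else 0) * u m j))"
      unfolding cnj_sum complex_cnj_mult by (rule sesquilinear_sum_expand)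
    also have "\<dots> = (\<Sum>l<n. \<Sum>m<n. cnj (c l) * c m * (if l = m then complex_of_real 1 else 0))"
      by (intro sum.cong refl) (simp add: if_distrib if_distribR sum.delta O1 cong: if_cong)
    also have "\<dots> = complex_of_real (\<Sum>l<n. (cmod (c l))\<^sup>2)"
      by (subst diag) simp
    finally show "(\<Sum>i<n. (cmod (\<Sum>l<n. c l * u l i))\<^sup>2) = (\<Sum>l<n. (cmod (c l))\<^sup>2)"
      using of_real_eq_iff by blast
  next
    fix x i assume i: "i < n"
    have "(\<Sum>l<n. (\<Sum>k<n. cnj (u l k) * x k) * u l i) = (\<Sum>k<n. (\<Sum>l<n. u l i * cnj (u l k)) * x k)"
      unfolding sum_distrib_right by (subst sum.swap) (simp add: mult_ac)
    also have "\<dots> = x i" using i by (simp add: O2 if_distribR if_distrib sum.delta cong: if_cong)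
    finally show "(\<Sum>l<n. (\<Sum>k<n. cnj (u l k) * x k) * u l i) = x i" .
  qed
qed

text \<open>Zero rows pad the system to a square matrix, which is then singular; a kernel vector
  gives \<open>c\<close>. It is set to 0 off \<open>L\<close> so that sums over larger index sets
  reduce to \<open>L\<close>.\<close>

lemma underdetermined_system:
  fixes M :: "'s \<Rightarrow> 'l \<Rightarrow> 'a::field"
  assumes "finite L" "finite S" "card S < card L"
  shows "\<exists>c. (\<exists>l\<in>L. c l \<noteq> 0) \<and> (\<forall>l. l \<notin> L \<longrightarrow> c l = 0) \<and> (\<forall>s\<in>S. (\<Sum>l\<in>L. c l * M s l) = 0)"
proof -
  define n where "n = card L"
  obtain f where f: "bij_betw f {0..<n} L"
    using ex_bij_betw_nat_finite[OF assms(1)] by (auto simp: n_def)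
  obtain g where g: "bij_betw g {0..<card S} S" using ex_bij_betw_nat_finite[OF assms(2)] by auto
  define B where "B = mat n n (\<lambda>(i, j). if i < card S then M (g i) (f j) else 0)"
  have B: "B \<in> carrier_mat n n" by (simp add: B_def)
  \<comment> \<open>Row \<open>card S\<close> is the first padding row; it exists because
    \<open>card S < card L\<close>.\<close>
  have "det B = 0"
    using assms(3) by (subst laplace_expansion_row[OF B, of "card S"]) (auto simp: B_def n_def)
  then obtain v where v: "v \<in> carrier_vec n" "v \<noteq> 0\<^sub>v n" "B *\<^sub>v v = 0\<^sub>v n"
    using det_0_iff_vec_prod_zero[OF B] by blast
  define c where "c l = (if l \<in> L then vec_index v (the_inv_into {0..<n} f l) else 0)" for l
  have cf: "c (f i) = vec_index v i" if "i < n" for i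
    using that f by (auto simp: c_def bij_betw_def the_inv_into_f_f)
  have "\<exists>i<n. vec_index v i \<noteq> 0"
    using v(1,2) by (metis carrier_vecD eq_vecI index_zero_vec)
  hence "\<exists>l\<in>L. c l \<noteq> 0" using cf f by (metis atLeast0LessThan bij_betwE lessThan_iff)
  moreover have "(\<Sum>l\<in>L. c l * M s l) = 0" if s: "s \<in> S" for s
  proof -
    have "s \<in> g ` {0..<card S}" using g s by (simp add: bij_betw_def)
    then obtain i where i: "i < card S" "s = g i" by auto
    have "(\<Sum>l\<in>L. c l * M s l) = (\<Sum>j\<in>{0..<n}. c (f j) * M s (f j))"
      by (rule sum.reindex_bij_betw[symmetric, OF f])
    also have "\<dots> = vec_index (B *\<^sub>v v) i"
      using i assms(3) v(1) by (auto simp: scalar_prod_def cf B_def n_def mult.commute intro!: sum.cong)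
    also have "\<dots> = 0" using i assms(3) v(3) by (simp add: n_def)
    finally show ?thesis .
  qed
  ultimately show ?thesis by (intro exI[of _ c]) (auto simp: c_def)
qed

text \<open>A nonzero vector spanned by the eigenvectors \<open>L\<close> of \<open>B\<close> whose image has no component along
  the eigenvectors \<open>S\<close> of \<open>A\<close>: the dimension count behind the Courant-Fischer comparison.\<close>

lemma isometry_test_vector:
  assumes A: "A \<in> carrier_mat N N" "hermitian_mat A" and B: "B \<in> carrier_mat k k" "hermitian_mat B"
    and lin: "\<And>c y i. i < N \<Longrightarrow> T (\<lambda>i. \<Sum>l<k. c l * y l i) i = (\<Sum>l<k. c l * T (y l) i)"
    and iso: "\<And>x. (\<Sum>i<N. (cmod (T x i))\<^sup>2) = (\<Sum>i<k. (cmod (x i))\<^sup>2)"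
    and LS: "L \<subseteq> {..<k}" "S \<subseteq> {..<N}" "card S < card L"
  obtains x c d where "hform B x = (\<Sum>l\<in>L. eigval B (Suc l) * c l)"
    "hform A (T x) = (\<Sum>m\<in>{..<N} - S. eigval A (Suc m) * d m)"
    "\<And>l. c l \<ge> 0" "\<And>m. d m \<ge> 0" "(\<Sum>l\<in>L. c l) = (\<Sum>m\<in>{..<N} - S. d m)" "(\<Sum>l\<in>L. c l) > 0"
proof -
  obtain u where u: "\<And>c. hform B (\<lambda>i. \<Sum>l<k. c l * u l i) = (\<Sum>l<k. eigval B (Suc l) * (cmod (c l))\<^sup>2)"
    "\<And>c. (\<Sum>i<k. (cmod (\<Sum>l<k. c l * u l i))\<^sup>2) = (\<Sum>l<k. (cmod (c l))\<^sup>2)"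
    by (rule hermitian_eigenbasis[OF B]) blast
  obtain v where v: "\<And>c. hform A (\<lambda>i. \<Sum>l<N. c l * v l i) = (\<Sum>l<N. eigval A (Suc l) * (cmod (c l))\<^sup>2)"
    "\<And>c. (\<Sum>i<N. (cmod (\<Sum>l<N. c l * v l i))\<^sup>2) = (\<Sum>l<N. (cmod (c l))\<^sup>2)"
    "\<And>x i. i < N \<Longrightarrow> (\<Sum>l<N. (\<Sum>k<N. cnj (v l k) * x k) * v l i) = x i"
    by (rule hermitian_eigenbasis[OF A]) blast
  have fin: "finite L" "finite S" using LS finite_subset by auto
  \<comment> \<open>There is one equation for each \<open>s\<close> in \<open>S\<close>: by
    linearity of \<open>T\<close>, it makes the image of the combination orthogonal to
    \<open>v s\<close>.\<close>
  obtain c where c: "\<exists>l\<in>L. c l \<noteq> 0" "\<And>l. l \<notin> L \<Longrightarrow> c l = 0"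
    "\<And>s. s \<in> S \<Longrightarrow> (\<Sum>l\<in>L. c l * (\<Sum>i<N. cnj (v s i) * T (u l) i)) = 0"
    using underdetermined_system[OF fin LS(3), of "\<lambda>s l. \<Sum>i<N. cnj (v s i) * T (u l) i"] by blast
  define x where "x i = (\<Sum>l<k. c l * u l i)" for i
  define d where "d m = (\<Sum>i<N. cnj (v m i) * T x i)" for m
  have d0: "d m = 0" if "m \<in> S" for m
  proof -
    have "d m = (\<Sum>i<N. \<Sum>l<k. cnj (v m i) * (c l * T (u l) i))"
      unfolding d_def x_def by (intro sum.cong refl) (simp add: lin sum_distrib_left)
    also have "\<dots> = (\<Sum>l<k. c l * (\<Sum>i<N. cnj (v m i) * T (u l) i))"
      by (subst sum.swap) (simp add: sum_distrib_left mult_ac)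
    also have "\<dots> = (\<Sum>l\<in>L. c l * (\<Sum>i<N. cnj (v m i) * T (u l) i))"
      using LS c(2) by (intro sum.mono_neutral_right) auto
    also have "\<dots> = 0" using c(3) that by simp
    finally show ?thesis .
  qed
  have sumL: "(\<Sum>l<k. f l * (cmod (c l))\<^sup>2) = (\<Sum>l\<in>L. f l * (cmod (c l))\<^sup>2)" for f
    using LS c(2) by (intro sum.mono_neutral_right) auto
  have sumS: "(\<Sum>m<N. f m * (cmod (d m))\<^sup>2) = (\<Sum>m\<in>{..<N} - S. f m * (cmod (d m))\<^sup>2)" for f
    using LS d0 by (intro sum.mono_neutral_right) auto
  have Tx: "(\<Sum>l<N. d l * v l i) = T x i" if "i < N" for i
    unfolding d_def by (rule v(3)[OF that])
  show ?thesis
  \<comment> \<open>The weights are the squared moduli of the coordinates of \<open>x\<close> and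
    \<open>T x\<close> in the two eigenbases; \<open>iso\<close> makes their totals equal.\<close>
  proof (rule that[of x "\<lambda>l. (cmod (c l))\<^sup>2" "\<lambda>m. (cmod (d m))\<^sup>2"])
    show "hform B x = (\<Sum>l\<in>L. eigval B (Suc l) * (cmod (c l))\<^sup>2)"
      unfolding x_def u(1) by (rule sumL)
    have "hform A (T x) = hform A (\<lambda>i. \<Sum>l<N. d l * v l i)"
      by (rule hform_cong[OF A(1)]) (simp add: Tx)
    also have "\<dots> = (\<Sum>m\<in>{..<N} - S. eigval A (Suc m) * (cmod (d m))\<^sup>2)"
      unfolding v(1) by (rule sumS)
    finally show "hform A (T x) = (\<Sum>m\<in>{..<N} - S. eigval A (Suc m) * (cmod (d m))\<^sup>2)" .
    have "(\<Sum>l\<in>L. (cmod (c l))\<^sup>2) = (\<Sum>i<k. (cmod (x i))\<^sup>2)"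
      unfolding x_def u(2) using sumL[of "\<lambda>_. 1"] by simp
    also have "\<dots> = (\<Sum>i<N. (cmod (\<Sum>l<N. d l * v l i))\<^sup>2)"
      by (simp add: Tx iso)
    also have "\<dots> = (\<Sum>m\<in>{..<N} - S. (cmod (d m))\<^sup>2)"
      unfolding v(2) using sumS[of "\<lambda>_. 1"] by simp
    finally show "(\<Sum>l\<in>L. (cmod (c l))\<^sup>2) = (\<Sum>m\<in>{..<N} - S. (cmod (d m))\<^sup>2)" .
    obtain l where "l \<in> L" "c l \<noteq> 0" using c(1) by blast
    thus "(\<Sum>l\<in>L. (cmod (c l))\<^sup>2) > 0" using fin by (intro sum_pos2[of L l]) auto
  qed auto
qed

text \<open>The test vector lies in the span of the lowest \<open>j + 1\<close> eigenvectors of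
  \<open>B\<close>, and its image avoids the lowest \<open>j\<close> of \<open>A\<close>. Its
  Rayleigh quotient is thus at most the eigenvalue of \<open>B\<close> and at least that of
  \<open>A\<close>.\<close>

theorem eigval_le_of_hform_le:
  assumes A: "A \<in> carrier_mat N N" "hermitian_mat A" and B: "B \<in> carrier_mat k k" "hermitian_mat B"
    and lin: "\<And>c y i. i < N \<Longrightarrow> T (\<lambda>i. \<Sum>l<k. c l * y l i) i = (\<Sum>l<k. c l * T (y l) i)"
    and iso: "\<And>x. (\<Sum>i<N. (cmod (T x i))\<^sup>2) = (\<Sum>i<k. (cmod (x i))\<^sup>2)"
    and le: "\<And>x. hform A (T x) \<le> hform B x"
    and j: "j < k" "k \<le> N"
  shows "eigval A (Suc j) \<le> eigval B (Suc j)"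
proof -
  obtain x c d where x: "hform B x = (\<Sum>l\<in>{..j}. eigval B (Suc l) * c l)"
    "hform A (T x) = (\<Sum>m\<in>{..<N} - {..<j}. eigval A (Suc m) * d m)"
    "\<And>l. c l \<ge> 0" "\<And>m. d m \<ge> 0" "(\<Sum>l\<in>{..j}. c l) = (\<Sum>m\<in>{..<N} - {..<j}. d m)"
    "(\<Sum>l\<in>{..j}. c l) > (0::real)"
    by (rule isometry_test_vector[OF A B lin iso, of "{..j}" "{..<j}"]) (use j in auto)
  have "eigval A (Suc j) * (\<Sum>l\<in>{..j}. c l) \<le> hform A (T x)"
    unfolding x(2,5) sum_distrib_left using j
    by (intro sum_mono mult_right_mono hermitian_eigval(2)[OF A] x(4)) auto
  also have "\<dots> \<le> hform B x" by (rule le)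
  also have "\<dots> \<le> eigval B (Suc j) * (\<Sum>l\<in>{..j}. c l)"
    unfolding x(1) sum_distrib_left using j
    by (intro sum_mono mult_right_mono hermitian_eigval(2)[OF B] x(3)) auto
  finally show ?thesis using x(6) by simp
qed

text \<open>The mirror image, counted from the top: the highest \<open>k - j\<close> eigenvectors of
  \<open>B\<close> against the highest \<open>k - j - 1\<close> of \<open>A\<close>. Equal distance
  from the top of the spectrum produces the index shift \<open>N - k\<close>.\<close>

theorem eigval_ge_of_hform_ge:
  assumes A: "A \<in> carrier_mat N N" "hermitian_mat A" and B: "B \<in> carrier_mat k k" "hermitian_mat B"
    and lin: "\<And>c y i. i < N \<Longrightarrow> T (\<lambda>i. \<Sum>l<k. c l * y l i) i = (\<Sum>l<k. c l * T (y l) i)"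
    and iso: "\<And>x. (\<Sum>i<N. (cmod (T x i))\<^sup>2) = (\<Sum>i<k. (cmod (x i))\<^sup>2)"
    and ge: "\<And>x. hform A (T x) \<ge> hform B x"
    and j: "j < k" "k \<le> N"
  shows "eigval B (Suc j) \<le> eigval A (Suc (j + N - k))"
proof -
  define J where "J = j + N - k"
  have J: "J < N" using j by (auto simp: J_def)
  obtain x c d where x: "hform B x = (\<Sum>l\<in>{j..<k}. eigval B (Suc l) * c l)"
    "hform A (T x) = (\<Sum>m\<in>{..<N} - {J<..<N}. eigval A (Suc m) * d m)"
    "\<And>l. c l \<ge> 0" "\<And>m. d m \<ge> 0" "(\<Sum>l\<in>{j..<k}. c l) = (\<Sum>m\<in>{..<N} - {J<..<N}. d m)"
    "(\<Sum>l\<in>{j..<k}. c l) > (0::real)"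
    by (rule isometry_test_vector[OF A B lin iso, of "{j..<k}" "{J<..<N}"]) (use j in \<open>auto simp: J_def\<close>)
  have "eigval B (Suc j) * (\<Sum>l\<in>{j..<k}. c l) \<le> hform B x"
    unfolding x(1) sum_distrib_left using j
    by (intro sum_mono mult_right_mono hermitian_eigval(2)[OF B] x(3)) auto
  also have "\<dots> \<le> hform A (T x)" by (rule ge)
  also have "\<dots> \<le> eigval A (Suc J) * (\<Sum>l\<in>{j..<k}. c l)"
    unfolding x(2,5) sum_distrib_left using J
    by (intro sum_mono mult_right_mono hermitian_eigval(2)[OF A] x(4)) auto
  finally show ?thesis using x(6) by (simp add: J_def)
qed

section \<open>Forms rewritten as sums over vertices\<close>

lemma sum_nth_distinct: "distinct xs \<Longrightarrow> (\<Sum>i<length xs. \<phi> (xs ! i)) = (\<Sum>v\<in>set xs. \<phi> v)"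
  by (rule sum.reindex_bij_betw) (auto intro: bij_betw_nth)

text \<open>This is how the Dirichlet condition enters: vectors vanish at the boundary vertices,
  which the enumeration puts last.\<close>

lemma hform_zero_pad:
  assumes "A \<in> carrier_mat n n" "B \<in> carrier_mat d d" "d \<le> n"
    and "\<And>i j. i < d \<Longrightarrow> j < d \<Longrightarrow> B $$ (i, j) = A $$ (i, j)"
  shows "hform A (\<lambda>i. if i < d then x i else 0) = hform B x"
proof -
  let ?y = "\<lambda>i. if i < d then x i else 0"
  have "(\<Sum>i<n. \<Sum>j<n. cnj (?y i) * A $$ (i, j) * ?y j) =
      (\<Sum>i<d. \<Sum>j<n. cnj (?y i) * A $$ (i, j) * ?y j)"
    using assms(3) by (intro sum.mono_neutral_right) auto
  also have "\<dots> = (\<Sum>i<d. \<Sum>j<d. cnj (?y i) * A $$ (i, j) * ?y j)"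
    using assms(3) by (intro sum.cong refl sum.mono_neutral_right) auto
  also have "\<dots> = (\<Sum>i<d. \<Sum>j<d. cnj (x i) * B $$ (i, j) * x j)"
    using assms(4) by (intro sum.cong refl) auto
  finally show ?thesis using assms(1,2) by (simp add: hform_def)
qed

lemma hform_diagonal:
  "hform (mat n n (\<lambda>(i, j). if i = j then complex_of_real (f i) else 0)) x =
    (\<Sum>i<n. f i * (cmod (x i))\<^sup>2)"
proof -
  have "(\<Sum>i<n. \<Sum>j<n. cnj (x i) * mat n n (\<lambda>(i, j). if i = j then complex_of_real (f i) else 0) $$ (i, j) * x j) =
      (\<Sum>i<n. \<Sum>j<n. if j = i then complex_of_real (f i * (cmod (x i))\<^sup>2) else 0)"
    using complex_norm_square by (intro sum.cong refl) (auto simp: mult_ac)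
  also have "\<dots> = complex_of_real (\<Sum>i<n. f i * (cmod (x i))\<^sup>2)" by (simp add: sum.delta)
  finally show ?thesis by (simp add: hform_def)
qed

lemma hform_op_sum:
  assumes "distinct xs" "A \<in> carrier_mat (length xs) (length xs)"
    and "\<And>i j. i < length xs \<Longrightarrow> j < length xs \<Longrightarrow> A $$ (i, j) = K (xs ! i) (xs ! j)"
  shows "hform A (\<lambda>i. f (xs ! i)) = Re (\<Sum>v\<in>set xs. \<Sum>w\<in>set xs. cnj (f v) * K v w * f w)"
proof -
  have "(\<Sum>i<length xs. \<Sum>j<length xs. cnj (f (xs ! i)) * A $$ (i, j) * f (xs ! j)) =
      (\<Sum>i<length xs. \<Sum>j<length xs. cnj (f (xs ! i)) * K (xs ! i) (xs ! j) * f (xs ! j))"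
    using assms(3) by (intro sum.cong refl) auto
  also have "\<dots> = (\<Sum>i<length xs. \<Sum>w\<in>set xs. cnj (f (xs ! i)) * K (xs ! i) w * f w)"
    by (intro sum.cong refl sum_nth_distinct assms(1))
  also have "\<dots> = (\<Sum>v\<in>set xs. \<Sum>w\<in>set xs. cnj (f v) * K v w * f w)"
    by (rule sum_nth_distinct[OF assms(1)])
  finally show ?thesis using assms(2) by (simp add: hform_def)
qed


subsection \<open>Multigraphs, lattices and the fundamental cell\<close>

lemma Upair_commute: "Upair u v = Upair v u"
  by simp

lemma oriented_edges_commute: "oriented_edges H u v = oriented_edges H v u"
  by (auto simp: oriented_edges_def Upair_inject Upair_commute[of u v] eq_commute[of u v])

lemma oriented_edges_nonzeroE:
  assumes "oriented_edges H u v \<noteq> 0"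
  obtains e where "e \<in> edges H" "ends H e = Upair u v"
proof -
  have "{e\<in>edges H. ends H e = Upair u v} \<noteq> {}"
    using assms unfolding oriented_edges_def by (metis card.empty mult_0_right)
  thus ?thesis using that by blast
qed

text \<open>The share of a single edge in \<open>oriented_edges\<close>, introduced to exchange sums
  over pairs of vertices for sums over edges.\<close>

definition darts :: "('v, 'e) mgraph \<Rightarrow> 'e \<Rightarrow> 'v \<Rightarrow> 'v \<Rightarrow> nat" where
  "darts H e v w = (if ends H e = Upair v w then if v = w then 2 else 1 else 0)"

text \<open>There is one term per orientation. For a loop the two terms coincide, which accounts for
  the 2 in \<open>darts\<close>.\<close>

lemma sum_darts:
  fixes F :: "'v \<Rightarrow> 'v \<Rightarrow> real"
  assumes "ends H e = Upair p q" "finite A" "finite B"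
  shows "(\<Sum>v\<in>A. \<Sum>w\<in>B. real (darts H e v w) * F v w) =
    (if p \<in> A \<and> q \<in> B then F p q else 0) + (if q \<in> A \<and> p \<in> B then F q p else 0)"
proof -
  have "real (darts H e v w) * F v w =
      (if v = p \<and> w = q then F p q else 0) + (if v = q \<and> w = p then F q p else 0)" for v w
    unfolding darts_def assms(1) Upair_inject
    by (cases "v = p"; cases "w = q"; cases "v = q"; cases "w = p") simp_all
  moreover have "(\<Sum>v\<in>A. \<Sum>w\<in>B. if v = p \<and> w = q then c else 0) =
      (if p \<in> A \<and> q \<in> B then c else 0)" for p q and c :: real
  proof -
    have "(\<Sum>v\<in>A. \<Sum>w\<in>B. if v = p \<and> w = q then c else 0) =
        (\<Sum>v\<in>A. if v = p then if q \<in> B then c else 0 else 0)"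
      using assms(3) by (intro sum.cong refl) auto
    thus ?thesis using assms(2) by (simp add: sum.delta)
  qed
  ultimately show ?thesis by (simp only: sum.distrib)
qed

lemma oriented_edges_eq_sum_darts:
  assumes "finite E'" "E' \<subseteq> edges H" "{e\<in>edges H. ends H e = Upair v w} \<subseteq> E'"
  shows "oriented_edges H v w = (\<Sum>e\<in>E'. darts H e v w)"
proof -
  have "(\<Sum>e\<in>E'. darts H e v w) = (\<Sum>e\<in>{e\<in>E'. ends H e = Upair v w}. if v = w then 2 else 1)"
    unfolding darts_def by (rule sum.inter_filter[symmetric, OF assms(1)])
  also have "{e\<in>E'. ends H e = Upair v w} = {e\<in>edges H. ends H e = Upair v w}"
    using assms by auto
  finally show ?thesis by (simp add: oriented_edges_def)
qed

text \<open>Only edges touching \<open>A\<close> contribute, so a finite \<open>E'\<close> can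
  suffice in an infinite graph.\<close>

lemma sum_oriented_edges:
  fixes F :: "'v \<Rightarrow> 'v \<Rightarrow> real"
  assumes "finite E'" "E' \<subseteq> edges H" "{e\<in>edges H. set_uprod (ends H e) \<inter> A \<noteq> {}} \<subseteq> E'"
  shows "(\<Sum>v\<in>A. \<Sum>w\<in>B. real (oriented_edges H v w) * F v w) =
    (\<Sum>e\<in>E'. \<Sum>v\<in>A. \<Sum>w\<in>B. real (darts H e v w) * F v w)"
proof -
  have "real (oriented_edges H v w) * F v w = (\<Sum>e\<in>E'. real (darts H e v w) * F v w)"
    if "v \<in> A" for v w
  proof -
    have "{e\<in>edges H. ends H e = Upair v w} \<subseteq> E'" using assms(3) that by auto
    from oriented_edges_eq_sum_darts[OF assms(1,2) this] show ?thesis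
      by (simp add: sum_distrib_right)
  qed
  hence "(\<Sum>v\<in>A. \<Sum>w\<in>B. real (oriented_edges H v w) * F v w) =
      (\<Sum>v\<in>A. \<Sum>w\<in>B. \<Sum>e\<in>E'. real (darts H e v w) * F v w)" by simp
  also have "\<dots> = (\<Sum>v\<in>A. \<Sum>e\<in>E'. \<Sum>w\<in>B. real (darts H e v w) * F v w)"
    by (intro sum.cong refl sum.swap)
  also have "\<dots> = (\<Sum>e\<in>E'. \<Sum>v\<in>A. \<Sum>w\<in>B. real (darts H e v w) * F v w)" by (rule sum.swap)
  finally show ?thesis .
qed

lemma vdegree_eq_sum_oriented_edges:
  assumes "finite {e\<in>edges H. v \<in> set_uprod (ends H e)}" "finite B"
    and "\<And>e w. e \<in> edges H \<Longrightarrow> ends H e = Upair v w \<Longrightarrow> w \<in> B"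
  shows "real (vdegree H v) = (\<Sum>w\<in>B. real (oriented_edges H v w))"
proof -
  define E' where "E' = {e\<in>edges H. v \<in> set_uprod (ends H e)}"
  have fin: "finite E'" using assms(1) by (simp add: E'_def)
  have "(\<Sum>w\<in>B. real (oriented_edges H v w)) =
      (\<Sum>v\<in>{v}. \<Sum>w\<in>B. real (oriented_edges H v w) * 1)" by simp
  also have "\<dots> = (\<Sum>e\<in>E'. \<Sum>v\<in>{v}. \<Sum>w\<in>B. real (darts H e v w) * 1)"
    by (rule sum_oriented_edges) (use fin in \<open>auto simp: E'_def\<close>)
  also have "\<dots> = (\<Sum>e\<in>E'. 1 + (if ends H e = Upair v v then 1 else 0))"
  proof (rule sum.cong[OF refl])
    fix e assume e: "e \<in> E'"
    obtain w where w: "ends H e = Upair v w"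
      using e by (cases "ends H e") (auto simp: E'_def Upair_commute)
    hence "w \<in> B" using assms(3) e by (auto simp: E'_def)
    thus "(\<Sum>v\<in>{v}. \<Sum>w\<in>B. real (darts H e v w) * 1) = 1 + (if ends H e = Upair v v then 1 else 0)"
      by (subst sum_darts[OF w]) (use w assms(2) in auto)
  qed
  also have "\<dots> = real (card E') + (\<Sum>e\<in>E'. if ends H e = Upair v v then 1 else 0)"
    by (simp add: sum.distrib)
  also have "(\<Sum>e\<in>E'. if ends H e = Upair v v then 1 else 0) =
      real (card {e\<in>E'. ends H e = Upair v v})"
    by (subst sum.inter_filter[symmetric, OF fin]) simp
  also have "{e\<in>E'. ends H e = Upair v v} = {e\<in>edges H. ends H e = Upair v v}"
    by (auto simp: E'_def)
  finally show ?thesis by (simp add: vdegree_def E'_def)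
qed

section \<open>Lattice translations and the half-open cell\<close>

lemma lattice_vec_add: "lattice_vec a (m + n) = lattice_vec a m + lattice_vec a n"
  by (simp add: lattice_vec_def sum.distrib scaleR_add_left)

lemma lattice_vec_0 [simp]: "lattice_vec a 0 = 0"
  by (simp add: lattice_vec_def)

lemma lattice_vec_uminus: "lattice_vec a (- m) = - lattice_vec a m"
  by (simp add: lattice_vec_def sum_negf)

lemma basis_bij:
  fixes a :: "'d::finite \<Rightarrow> real^'d"
  assumes "is_basis a"
  shows "bij (\<lambda>t :: real^'d. \<Sum>s\<in>UNIV. (t $ s) *\<^sub>R a s)"
proof -
  let ?f = "\<lambda>t :: real^'d. \<Sum>s\<in>UNIV. (t $ s) *\<^sub>R a s"
  have lin: "linear ?f"
    by (rule linearI) (simp_all add: scaleR_add_left sum.distrib scaleR_sum_right)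
  have "x \<in> range ?f" for x
  proof -
    have "x \<in> span (range a)" using assms by (simp add: is_basis_def)
    then obtain u where "x = (\<Sum>v\<in>range a. u v *\<^sub>R v)" by (auto simp: span_finite)
    also have "\<dots> = (\<Sum>s\<in>UNIV. u (a s) *\<^sub>R a s)"
      using assms by (simp add: sum.reindex is_basis_def)
    also have "\<dots> = ?f (\<chi> s. u (a s))" by simp
    finally show ?thesis by blast
  qed
  hence "surj ?f" by auto
  thus ?thesis using linear_surjective_imp_injective[OF lin] by (simp add: bij_def)
qed

text \<open>The coordinates of \<open>m\<close> are the integer parts of those of
  \<open>w - z\<close>; half-open unit intervals leave exactly one choice in each
  coordinate.\<close>

lemma cell_shift_unique:
  fixes a :: "'d::finite \<Rightarrow> real^'d"
  assumes "is_basis a"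
  shows "\<exists>!m. w - lattice_vec a m \<in> {z + (\<Sum>s\<in>UNIV. t s *\<^sub>R a s) | t. \<forall>s. 0 \<le> t s \<and> t s < 1}"
proof -
  let ?f = "\<lambda>t :: real^'d. \<Sum>s\<in>UNIV. (t $ s) *\<^sub>R a s"
  obtain t where t: "w - z = ?f t" using basis_bij[OF assms] by (meson bij_pointE)
  have lv: "lattice_vec a m = ?f (\<chi> s. of_int (m $ s))" for m by (simp add: lattice_vec_def)
  have diff: "w - lattice_vec a m = z + ?f (\<chi> s. t $ s - of_int (m $ s))" for m
    unfolding lv using t by (simp add: scaleR_diff_left sum_subtractf algebra_simps)
  have *: "w - lattice_vec a m \<in> {z + (\<Sum>s\<in>UNIV. t s *\<^sub>R a s) | t. \<forall>s. 0 \<le> t s \<and> t s < 1} \<longleftrightarrow>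
      (\<forall>s. 0 \<le> t $ s - of_int (m $ s) \<and> t $ s - of_int (m $ s) < 1)" for m
  proof
    assume "w - lattice_vec a m \<in> {z + (\<Sum>s\<in>UNIV. t s *\<^sub>R a s) | t. \<forall>s. 0 \<le> t s \<and> t s < 1}"
    then obtain r where r: "w - lattice_vec a m = z + (\<Sum>s\<in>UNIV. r s *\<^sub>R a s)"
      "\<forall>s. 0 \<le> r s \<and> r s < 1" by blast
    hence "?f (\<chi> s. t $ s - of_int (m $ s)) = ?f (\<chi> s. r s)" using diff[of m] by simp
    hence eq: "(\<chi> s. t $ s - of_int (m $ s)) = (\<chi> s. r s)"
      by (rule injD[OF bij_is_inj[OF basis_bij[OF assms]]])
    have "t $ s - of_int (m $ s) = r s" for s using arg_cong[OF eq, of "\<lambda>x. x $ s"] by simp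
    thus "\<forall>s. 0 \<le> t $ s - of_int (m $ s) \<and> t $ s - of_int (m $ s) < 1" using r(2) by simp
  next
    assume "\<forall>s. 0 \<le> t $ s - of_int (m $ s) \<and> t $ s - of_int (m $ s) < 1"
    thus "w - lattice_vec a m \<in> {z + (\<Sum>s\<in>UNIV. t s *\<^sub>R a s) | t. \<forall>s. 0 \<le> t s \<and> t s < 1}"
      unfolding diff by (intro CollectI exI[of _ "\<lambda>s. t $ s - of_int (m $ s)"]) simp
  qed
  show ?thesis unfolding *
  proof (rule ex1I[of _ "\<chi> s. \<lfloor>t $ s\<rfloor>"])
    show "\<forall>s. 0 \<le> t $ s - of_int ((\<chi> s. \<lfloor>t $ s\<rfloor>) $ s) \<and> t $ s - of_int ((\<chi> s. \<lfloor>t $ s\<rfloor>) $ s) < 1"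
      by (simp, linarith)
  next
    fix m :: "int^'d" assume "\<forall>s. 0 \<le> t $ s - of_int (m $ s) \<and> t $ s - of_int (m $ s) < 1"
    hence "\<lfloor>t $ s\<rfloor> = m $ s" for s by (intro floor_unique) (auto simp: algebra_simps)
    thus "m = (\<chi> s. \<lfloor>t $ s\<rfloor>)" by (simp add: vec_eq_iff)
  qed
qed

section \<open>Representatives of vertices in the cell\<close>

locale fundamental_domain =
  fixes a :: "'d::finite \<Rightarrow> real^'d" and z :: "real^'d"
    and G :: "(real^'d, 'e) mgraph"
    and tr :: "int^'d \<Rightarrow> 'e \<Rightarrow> 'e"
    and BN :: "'e set"
  assumes periodic: "periodic_graph a G tr"
    and choice: "bridge_choice (cell_verts a z G) G tr BN"
begin

abbreviation L where "L \<equiv> lattice_vec a"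
abbreviation V where "V \<equiv> verts G"
abbreviation VF where "VF \<equiv> cell_verts a z G"
abbreviation GN where "GN \<equiv> finite_graph VF G BN"
abbreviation VN where "VN \<equiv> verts GN"

lemma verts_translate: "v + L m \<in> V \<longleftrightarrow> v \<in> V"
proof -
  have *: "(\<lambda>v. v + L m) ` V = V" for m using periodic by (simp add: periodic_graph_def)
  show ?thesis
  proof
    assume "v + L m \<in> V"
    hence "v + L m + L (- m) \<in> V" using *[of "- m"] by blast
    thus "v \<in> V" by (simp add: lattice_vec_uminus)
  next
    assume "v \<in> V" thus "v + L m \<in> V" using *[of m] by blast
  qed
qed

lemma verts_translate_diff: "v - L m \<in> V \<longleftrightarrow> v \<in> V"
  using verts_translate[of v "- m"] by (simp add: lattice_vec_uminus)

lemma edge_translate: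
  assumes "e \<in> edges G"
  shows "tr m e \<in> edges G" "ends G (tr m e) = map_uprod (\<lambda>v. v + L m) (ends G e)"
    "tr (- m) (tr m e) = e" "tr m (tr (- m) e) = e" "tr 0 e = e"
proof -
  show "tr m e \<in> edges G" "ends G (tr m e) = map_uprod (\<lambda>v. v + L m) (ends G e)" "tr 0 e = e"
    using periodic assms by (simp_all add: periodic_graph_def)
  have "tr (m + n) e = tr m (tr n e)" "tr 0 e = e" for m n
    using periodic assms by (simp_all add: periodic_graph_def)
  from this(1)[of "- m" m] this(1)[of m "- m"] this(2)
  show "tr (- m) (tr m e) = e" "tr m (tr (- m) e) = e" by simp_all
qed

lemma ends_in_verts: "e \<in> edges G \<Longrightarrow> ends G e = Upair u w \<Longrightarrow> u \<in> V \<and> w \<in> V"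
  using periodic by (auto simp: periodic_graph_def wf_mgraph_def)

lemma finite_edges_at: "v \<in> V \<Longrightarrow> finite {e\<in>edges G. v \<in> set_uprod (ends G e)}"
  using periodic by (simp add: periodic_graph_def)

lemma VF_subset: "VF \<subseteq> V"
  by (auto simp: cell_verts_def)

lemma finite_VF: "finite VF"
proof -
  let ?C = "{z + (\<Sum>s\<in>UNIV. t s *\<^sub>R a s) | t. \<forall>s. 0 \<le> t s \<and> t s < 1}"
  have "norm x \<le> norm z + (\<Sum>s\<in>UNIV. norm (a s))" if x: "x \<in> ?C" for x
  proof -
    obtain t where t: "x = z + (\<Sum>s\<in>UNIV. t s *\<^sub>R a s)" "\<forall>s. 0 \<le> t s \<and> t s < 1"
      using x by blast
    have "norm (\<Sum>s\<in>UNIV. t s *\<^sub>R a s) \<le> (\<Sum>s\<in>UNIV. norm (a s))"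
    proof (rule sum_norm_le)
      fix s show "norm (t s *\<^sub>R a s) \<le> norm (a s)"
        using t(2)[rule_format, of s] by (simp add: mult_left_le_one_le)
    qed
    thus ?thesis unfolding t(1) by (meson add_left_mono norm_triangle_le order_refl order_trans norm_triangle_ineq)
  qed
  hence "bounded ?C" by (meson boundedI)
  moreover have "\<forall>S. bounded S \<longrightarrow> finite (V \<inter> S)" using periodic by (simp add: periodic_graph_def)
  ultimately have "finite (V \<inter> ?C)" by blast
  thus ?thesis unfolding cell_verts_def by (simp only: Int_commute)
qed

lemma VF_shift_unique: "w \<in> V \<Longrightarrow> \<exists>!m. w - L m \<in> VF"
  using cell_shift_unique[of a w z] periodic
  by (simp add: cell_verts_def periodic_graph_def verts_translate_diff)

text \<open>\<open>shift\<close> and \<open>base\<close> are the integer and fractional parts of a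
  vertex in lattice coordinates. Off \<open>V\<close> no such \<open>m\<close> exists and the value
  is unspecified.\<close>

definition shift :: "real^'d \<Rightarrow> int^'d" where
  "shift w = (THE m. w - L m \<in> VF)"

definition base :: "real^'d \<Rightarrow> real^'d" where
  "base w = w - L (shift w)"

lemma base_in: "w \<in> V \<Longrightarrow> base w \<in> VF"
  unfolding base_def shift_def by (rule theI') (rule VF_shift_unique)

lemma base_plus: "base w + L (shift w) = w"
  by (simp add: base_def)

lemma shift_eqI: "w \<in> V \<Longrightarrow> w - L m \<in> VF \<Longrightarrow> shift w = m"
  using VF_shift_unique[of w] base_in[of w] by (auto simp: base_def)

lemma shift_translate: "w \<in> V \<Longrightarrow> shift (w + L m) = shift w + m"
  using base_in[of w] by (intro shift_eqI) (auto simp: verts_translate lattice_vec_add base_def algebra_simps)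

lemma base_translate: "w \<in> V \<Longrightarrow> base (w + L m) = base w"
  by (simp add: base_def shift_translate lattice_vec_add)

lemma shift_VF [simp]: "v \<in> VF \<Longrightarrow> shift v = 0"
  using VF_subset by (intro shift_eqI) auto

lemma base_VF [simp]: "v \<in> VF \<Longrightarrow> base v = v"
  by (simp add: base_def)

lemma VF_translate: "v \<in> VF \<Longrightarrow> v + L m \<in> VF \<longleftrightarrow> m = 0"
proof
  assume v: "v \<in> VF" and m: "v + L m \<in> VF"
  have "v \<in> V" using v VF_subset by auto
  from shift_translate[OF this, of m] show "m = 0" using v m by simp
qed simp

lemma VF_translate_diff: "v \<in> VF \<Longrightarrow> v - L m \<in> VF \<longleftrightarrow> m = 0"
  using VF_translate[of v "- m"] by (simp add: lattice_vec_uminus)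

lemma L_eq_0_iff: "v \<in> VF \<Longrightarrow> L m = 0 \<longleftrightarrow> m = 0"
  using VF_translate[of v m] by auto

section \<open>Edges meeting the cell and the finite graph\<close>

abbreviation Ein where "Ein \<equiv> inner_edges VF G"
abbreviation Br where "Br \<equiv> bridges VF G"

lemma edges_at_VF: "{e\<in>edges G. set_uprod (ends G e) \<inter> VF \<noteq> {}} = Ein \<union> Br"
proof (intro equalityI subsetI)
  fix e assume e: "e \<in> {e\<in>edges G. set_uprod (ends G e) \<inter> VF \<noteq> {}}"
  obtain p q where pq: "ends G e = Upair p q" by (cases "ends G e")
  from e pq ends_in_verts[OF _ pq] show "e \<in> Ein \<union> Br"
    by (auto simp: inner_edges_def bridges_def Upair_inject)
next
  fix e assume e: "e \<in> Ein \<union> Br"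
  obtain p q where pq: "ends G e = Upair p q" by (cases "ends G e")
  from e pq show "e \<in> {e\<in>edges G. set_uprod (ends G e) \<inter> VF \<noteq> {}}"
    by (auto simp: inner_edges_def bridges_def)
qed

lemma Ein_Br_disjoint: "Ein \<inter> Br = {}"
  by (auto simp: inner_edges_def bridges_def)

lemma finite_Ein_Br: "finite Ein" "finite Br"
proof -
  have "{e\<in>edges G. set_uprod (ends G e) \<inter> VF \<noteq> {}} =
      (\<Union>v\<in>VF. {e\<in>edges G. v \<in> set_uprod (ends G e)})" by auto
  moreover have "finite \<dots>"
    using finite_VF VF_subset by (intro finite_UN_I finite_edges_at) auto
  ultimately have "finite (Ein \<union> Br)" unfolding edges_at_VF by simp
  thus "finite Ein" "finite Br" by simp_all
qed

lemma BN_subset: "BN \<subseteq> Br"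
  using choice by (simp add: bridge_choice_def)

lemma BN_unique: "e \<in> Br \<Longrightarrow> \<exists>!e'. e' \<in> BN \<and> (\<exists>m. e' = tr m e)"
  using choice unfolding bridge_choice_def by blast

lemma Br_edges: "Br \<subseteq> edges G" "Ein \<subseteq> edges G"
  by (auto simp: bridges_def inner_edges_def)

lemma BrE:
  assumes "e \<in> Br"
  obtains p q where "p \<in> VF" "q \<in> V" "q \<notin> VF" "ends G e = Upair p q"
  using assms by (auto simp: bridges_def)

lemma VN_eq: "VN = VF \<union> {u\<in>V. \<exists>e\<in>BN. \<exists>v\<in>VF. ends G e = Upair u v}"
  and edges_GN: "edges GN = Ein \<union> BN" and ends_GN [simp]: "ends GN = ends G"
  by (simp_all add: finite_graph_def)

lemma VN_subset: "VF \<subseteq> VN" "VN \<subseteq> V"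
  using VF_subset by (auto simp: VN_eq)

lemma finite_edges_GN: "finite (edges GN)"
  using finite_Ein_Br BN_subset by (auto simp: edges_GN intro: finite_subset)

lemma finite_VN: "finite VN"
proof -
  have "VN \<subseteq> VF \<union> (\<Union>e\<in>BN. set_uprod (ends G e))" by (auto simp: VN_eq)
  moreover have "finite BN" using finite_Ein_Br BN_subset by (auto intro: finite_subset)
  ultimately show ?thesis using finite_VF by (auto intro: finite_subset)
qed

lemma ends_GN_in_VN: "e \<in> edges GN \<Longrightarrow> ends G e = Upair p q \<Longrightarrow> p \<in> VN \<and> q \<in> VN"
proof -
  assume e: "e \<in> edges GN" and pq: "ends G e = Upair p q"
  show ?thesis
  proof (cases "e \<in> BN")
    case True
    then obtain u w where uw: "u \<in> VF" "w \<in> V" "w \<notin> VF" "ends G e = Upair u w"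
      using BN_subset BrE by blast
    have "w \<in> VN" unfolding VN_eq using uw True by (auto simp: Upair_commute)
    moreover have "u \<in> VN" using uw VN_subset by auto
    ultimately show ?thesis using pq uw(4) by (auto simp: Upair_inject)
  next
    case False
    thus ?thesis using e pq VN_subset by (auto simp: edges_GN inner_edges_def)
  qed
qed

text \<open>A finite range for the second end of edges starting in the cell. In contrast to the
  definition of \<open>VN\<close>, the ends of all bridges are taken, not just of the chosen
  ones.\<close>

definition nbhd :: "(real^'d) set" where
  "nbhd = VF \<union> (\<Union>e\<in>Br. set_uprod (ends G e))"

lemma finite_nbhd: "finite nbhd"
  using finite_VF finite_Ein_Br by (auto simp: nbhd_def)

lemma oriented_edges_nbhd: "v \<in> VF \<Longrightarrow> oriented_edges G v w \<noteq> 0 \<Longrightarrow> w \<in> nbhd"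
proof -
  assume v: "v \<in> VF" and o: "oriented_edges G v w \<noteq> 0"
  from o obtain e where e: "e \<in> edges G" "ends G e = Upair v w"
    by (rule oriented_edges_nonzeroE)
  hence "e \<in> Ein \<union> Br" using v unfolding edges_at_VF[symmetric] by auto
  thus "w \<in> nbhd" using e(2) by (auto simp: nbhd_def inner_edges_def intro!: bexI[of _ e])
qed

text \<open>Every translation class of edges meeting the cell has exactly one member in \<open>GN\<close>; a bridge
  outside \<open>BN\<close> is the translate of the chosen bridge whose end points change roles.\<close>

theorem sum_oriented_edges_cell:
  fixes F :: "real^'d \<Rightarrow> real^'d \<Rightarrow> real"
  assumes inv: "\<And>u w m. u \<in> V \<Longrightarrow> w \<in> V \<Longrightarrow> F (u + L m) (w + L m) = F u w"
  shows "(\<Sum>v\<in>VF. \<Sum>w\<in>nbhd. real (oriented_edges G v w) * F v w) =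
         (\<Sum>v\<in>VN. \<Sum>w\<in>VN. real (oriented_edges GN v w) * F v w)"
proof -
  define h where "h e = (\<Sum>v\<in>VF. \<Sum>w\<in>nbhd. real (darts G e v w) * F v w)" for e
  define k where "k e = (\<Sum>v\<in>VN. \<Sum>w\<in>VN. real (darts G e v w) * F v w)" for e
  have fBN: "finite BN" using finite_Ein_Br BN_subset by (auto intro: finite_subset)
  have h_in: "h e = k e" if "e \<in> Ein" for e
  proof -
    obtain p q where pq: "ends G e = Upair p q" by (cases "ends G e")
    have "p \<in> VF" "q \<in> VF" using that pq by (auto simp: inner_edges_def)
    thus ?thesis
      unfolding h_def k_def sum_darts[OF pq finite_VF finite_nbhd] sum_darts[OF pq finite_VN finite_VN]
      using VN_subset by (auto simp: nbhd_def)
  qed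
  \<comment> \<open>Seen from the cell, a bridge has only the orientation leaving the cell; in
    \<open>GN\<close> a chosen bridge has both (\<open>k_br\<close>). The totals agree because two
    bridges share one representative.\<close>
  have h_br: "h e = F p q" if "e \<in> Br" "ends G e = Upair p q" "p \<in> VF" "q \<notin> VF" for e p q
    unfolding h_def sum_darts[OF that(2) finite_VF finite_nbhd] using that by (auto simp: nbhd_def)
  have k_br: "k e = F p q + F q p" if "e \<in> BN" "ends G e = Upair p q" for e p q
  proof -
    have "p \<in> VN" "q \<in> VN" using ends_GN_in_VN[of e p q] that by (auto simp: edges_GN)
    thus ?thesis unfolding k_def sum_darts[OF that(2) finite_VN finite_VN] by simp
  qed
  define r where "r b = (THE e. e \<in> BN \<and> (\<exists>m. e = tr m b))" for b
  have r: "r b \<in> BN \<and> (\<exists>m. r b = tr m b)" if "b \<in> Br" for b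
    unfolding r_def by (rule theI') (rule BN_unique[OF that])
  have r_eq: "r b = e" if "b \<in> Br" "e \<in> BN" "e = tr m b" for b e m
    using BN_unique[OF that(1)] r[OF that(1)] that by blast
  have cls: "(\<Sum>b\<in>{b\<in>Br. r b = e}. h b) = k e" if e: "e \<in> BN" for e
  proof -
    have eBr: "e \<in> Br" using e BN_subset by auto
    hence eG: "e \<in> edges G" using Br_edges by auto
    obtain p q where pq: "p \<in> VF" "q \<in> V" "q \<notin> VF" "ends G e = Upair p q" using eBr BrE by blast
    \<comment> \<open>Translation by \<open>- m\<close> brings the outer end \<open>q\<close> into
      the cell and, as \<open>m\<close> is nonzero, moves \<open>p\<close> out of it: this yields
      the partner bridge \<open>e'\<close>.\<close>
    define m where "m = shift q"
    have qm: "q - L m \<in> VF" using base_in[OF pq(2)] by (simp add: base_def m_def)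
    have m0: "m \<noteq> 0" using qm pq(3) by auto
    have pm: "p - L m \<notin> VF" "p - L m \<in> V"
      using VF_translate_diff[OF pq(1)] m0 pq(1) VF_subset by (auto simp: verts_translate_diff)
    define e' where "e' = tr (- m) e"
    have e': "e' \<in> edges G" "ends G e' = Upair (q - L m) (p - L m)" "tr m e' = e"
      using edge_translate[OF eG] pq(4) by (auto simp: e'_def lattice_vec_uminus Upair_commute)
    have e'Br: "e' \<in> Br" unfolding bridges_def using e' qm pm by blast
    \<comment> \<open>If they were equal, a nonzero translation would reverse the edge, and applying
      it twice would fix its ends.\<close>
    have "e \<noteq> e'"
    proof
      assume "e = e'"
      hence "Upair p q = Upair (q - L m) (p - L m)" using e'(2) pq(4) by metis
      hence "p = q - L m \<and> q = p - L m \<or> p = p - L m \<and> q = q - L m"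
        by (simp only: Upair_inject)
      moreover have "p \<noteq> p - L m" using L_eq_0_iff[OF pq(1)] m0 by simp
      ultimately have "p = q - L m \<and> q = p - L m" by blast
      hence "q = q - L m - L m" by metis
      hence "2 *\<^sub>R L m = 0" by (simp add: scaleR_2)
      thus False using L_eq_0_iff[OF pq(1)] m0 by simp
    qed
    have "{b\<in>Br. r b = e} = {e, e'}"
    proof (intro equalityI subsetI)
      fix b assume "b \<in> {b\<in>Br. r b = e}"
      hence b: "b \<in> Br" "r b = e" by auto
      then obtain n where n: "e = tr n b" using r by metis
      have bG: "b \<in> edges G" using b Br_edges by auto
      have b': "b = tr (- n) e" unfolding n using edge_translate(3)[OF bG] by simp
      hence eb: "ends G b = Upair (p - L n) (q - L n)"
        using edge_translate(2)[OF eG, of "- n"] pq(4) by (simp add: lattice_vec_uminus)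
      \<comment> \<open>A bridge has an end in the cell. Uniqueness of the cell representative
        allows \<open>n = 0\<close> for \<open>p\<close> and \<open>n = m\<close> for
        \<open>q\<close>, so the class is exactly a pair.\<close>
      from b(1) eb have "p - L n \<in> VF \<or> q - L n \<in> VF"
        by (elim BrE) (auto simp: Upair_inject)
      hence "n = 0 \<or> n = m"
        using VF_translate_diff[OF pq(1)] shift_eqI[OF pq(2)] by (auto simp: m_def)
      thus "b \<in> {e, e'}" using b' edge_translate(5)[OF eG] by (auto simp: e'_def)
    next
      fix b assume "b \<in> {e, e'}"
      thus "b \<in> {b\<in>Br. r b = e}"
        using eBr e'Br r_eq[OF eBr e, of 0] edge_translate(5)[OF eG] r_eq[OF e'Br e, of m] e'(3) by auto
    qed
    hence "(\<Sum>b\<in>{b\<in>Br. r b = e}. h b) = h e + h e'" using \<open>e \<noteq> e'\<close> by simp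
    also have "h e = F p q" by (rule h_br[OF eBr pq(4,1,3)])
    also have "h e' = F (q - L m) (p - L m)" by (rule h_br[OF e'Br e'(2) qm pm(1)])
    also have "\<dots> = F q p"
      using inv[of q p "- m"] pq(1,2) VF_subset by (auto simp: lattice_vec_uminus)
    finally show ?thesis by (simp add: k_br[OF e pq(4)])
  qed
  have "(\<Sum>v\<in>VF. \<Sum>w\<in>nbhd. real (oriented_edges G v w) * F v w) = (\<Sum>e\<in>Ein \<union> Br. h e)"
    unfolding h_def using finite_Ein_Br Br_edges edges_at_VF by (intro sum_oriented_edges) auto
  also have "\<dots> = (\<Sum>e\<in>Ein. h e) + (\<Sum>b\<in>Br. h b)"
    using finite_Ein_Br Ein_Br_disjoint by (intro sum.union_disjoint) auto
  also have "(\<Sum>b\<in>Br. h b) = (\<Sum>e\<in>BN. \<Sum>b\<in>{b\<in>Br. r b = e}. h b)"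
    using finite_Ein_Br fBN r by (intro sum.group[symmetric]) auto
  also have "\<dots> = (\<Sum>e\<in>BN. k e)" by (simp add: cls)
  also have "(\<Sum>e\<in>Ein. h e) = (\<Sum>e\<in>Ein. k e)" by (simp add: h_in)
  also have "(\<Sum>e\<in>Ein. k e) + (\<Sum>e\<in>BN. k e) = (\<Sum>e\<in>edges GN. k e)"
    unfolding edges_GN using finite_Ein_Br Ein_Br_disjoint BN_subset fBN
    by (intro sum.union_disjoint[symmetric]) auto
  also have "\<dots> = (\<Sum>v\<in>VN. \<Sum>w\<in>VN. real (oriented_edges GN v w) * F v w)"
    unfolding k_def using finite_edges_GN
    by (subst sum_oriented_edges[of "edges GN"]) (auto simp: darts_def)
  finally show ?thesis .
qed

lemma vdegree_cell: "v \<in> VF \<Longrightarrow> real (vdegree G v) = (\<Sum>w\<in>nbhd. real (oriented_edges G v w))"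
proof (rule vdegree_eq_sum_oriented_edges)
  fix e w assume v: "v \<in> VF" and e: "e \<in> edges G" "ends G e = Upair v w"
  hence "e \<in> Ein \<union> Br" unfolding edges_at_VF[symmetric] by auto
  thus "w \<in> nbhd" using e(2) by (auto simp: nbhd_def inner_edges_def intro!: bexI[of _ e])
qed (use VF_subset finite_edges_at finite_nbhd in auto)

lemma vdegree_GN: "real (vdegree GN v) = (\<Sum>w\<in>VN. real (oriented_edges GN v w))"
  using finite_edges_GN finite_VN ends_GN_in_VN by (intro vdegree_eq_sum_oriented_edges) auto

section \<open>Lattice orbits in the finite graph\<close>

lemma rho_eq: "w \<in> V \<Longrightarrow> rho a GN w = card {u\<in>VN. base u = base w}"
proof -
  assume w: "w \<in> V"
  have "range (\<lambda>m. w + L m) \<inter> VN = {u\<in>VN. base u = base w}"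
  proof (intro equalityI subsetI)
    fix u assume "u \<in> {u\<in>VN. base u = base w}"
    hence u: "u \<in> VN" "base u = base w" by auto
    have "u = base w + L (shift w + (shift u - shift w))" using base_plus[of u] u(2) by simp
    also have "\<dots> = w + L (shift u - shift w)"
      unfolding lattice_vec_add by (simp add: base_plus add.assoc[symmetric])
    finally have "u = w + L (shift u - shift w)" .
    thus "u \<in> range (\<lambda>m. w + L m) \<inter> VN" using u(1) by blast
  qed (use w base_translate in auto)
  thus ?thesis by (simp add: rho_def)
qed

lemma rho_pos: "w \<in> VN \<Longrightarrow> rho a GN w > 0"
  using VN_subset finite_VN by (subst rho_eq) (auto simp: card_gt_0_iff)

text \<open>The orbit of a cell vertex meets \<open>VN\<close> in \<open>rho\<close> points, itself
  among them, each of weight \<open>1 / rho\<close>. This gives both the isometry and the potential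
  part of the form.\<close>

lemma sum_VN_rho:
  fixes \<phi> :: "real^'d \<Rightarrow> real"
  shows "(\<Sum>w\<in>VN. \<phi> (base w) / rho a GN w) = (\<Sum>v\<in>VF. \<phi> v)"
proof -
  have "(\<Sum>w\<in>VN. \<phi> (base w) / rho a GN w) =
      (\<Sum>v\<in>VF. \<Sum>w\<in>{w\<in>VN. base w = v}. \<phi> (base w) / rho a GN w)"
    using finite_VF finite_VN VN_subset base_in by (intro sum.group[symmetric]) auto
  also have "\<dots> = (\<Sum>v\<in>VF. \<phi> v)"
  proof (rule sum.cong[OF refl])
    fix v assume v: "v \<in> VF"
    have "(\<Sum>w\<in>{w\<in>VN. base w = v}. \<phi> (base w) / rho a GN w) =
        (\<Sum>w\<in>{w\<in>VN. base w = v}. \<phi> v / rho a GN v)"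
    proof (rule sum.cong[OF refl])
      fix w assume "w \<in> {w\<in>VN. base w = v}"
      thus "\<phi> (base w) / rho a GN w = \<phi> v / rho a GN v"
        using rho_eq[of w] rho_eq[of v] v VN_subset VF_subset by (auto simp: subset_iff)
    qed
    also have "\<dots> = rho a GN v * (\<phi> v / rho a GN v)"
      using rho_eq[of v] v VF_subset by auto
    also have "\<dots> = \<phi> v" using rho_pos[of v] v VN_subset by auto
    finally show "(\<Sum>w\<in>{w\<in>VN. base w = v}. \<phi> (base w) / rho a GN w) = \<phi> v" .
  qed
  finally show ?thesis .
qed

text \<open>A second representative of an inner vertex \<open>v\<close> in \<open>VN\<close> would be the end of a chosen
  bridge; its translate ending at \<open>v\<close> would be chosen too, as all edges at \<open>v\<close> are in \<open>GN\<close>.\<close>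

lemma inner_vert_unique:
  assumes v: "v \<in> inner_verts G GN" "v \<in> VF" and w: "w \<in> VN" "base w = v"
  shows "w = v"
proof (rule ccontr)
  assume "w \<noteq> v"
  define m where "m = shift w"
  have wm: "w = v + L m" using base_plus[of w] w(2) by (simp add: m_def)
  have m0: "m \<noteq> 0" using \<open>w \<noteq> v\<close> wm by auto
  hence "w \<notin> VF" using VF_translate[OF v(2)] wm by simp
  then obtain e p where e: "e \<in> BN" "p \<in> VF" "ends G e = Upair w p" using w(1) by (auto simp: VN_eq)
  have eG: "e \<in> edges G" "e \<in> Br" using e(1) BN_subset Br_edges by auto
  define e' where "e' = tr (- m) e"
  have e': "e' \<in> edges G" "ends G e' = Upair v (p - L m)"
    using edge_translate[OF eG(1)] e(3) wm by (auto simp: e'_def lattice_vec_uminus)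
  \<comment> \<open>Passing to \<open>GN\<close> can only shrink either summand of the degree, so
    equal degrees force every edge at \<open>v\<close> to survive.\<close>
  have "e' \<in> edges GN"
  proof -
    let ?S = "\<lambda>H. {e\<in>edges H. v \<in> set_uprod (ends H e)}"
    let ?T = "\<lambda>H. {e\<in>edges H. ends H e = Upair v v}"
    have fin: "finite (?S G)" using v(2) VF_subset finite_edges_at by auto
    moreover have "?T G \<subseteq> ?S G" by auto
    ultimately have fin': "finite (?T G)" by (rule finite_subset[rotated])
    have sub: "edges GN \<subseteq> edges G" using Br_edges BN_subset by (auto simp: edges_GN)
    have "card (?S GN) \<le> card (?S G)" "card (?T GN) \<le> card (?T G)"
      using fin fin' sub by (auto intro!: card_mono)
    moreover have "card (?S GN) + card (?T GN) = card (?S G) + card (?T G)"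
      using v(1) by (simp add: inner_verts_def vdegree_def)
    ultimately have "card (?S GN) = card (?S G)" by linarith
    moreover have "?S GN \<subseteq> ?S G" using sub by auto
    ultimately have "?S GN = ?S G" using card_subset_eq[OF fin] by blast
    moreover have "e' \<in> ?S G" using e' by auto
    ultimately show ?thesis by auto
  qed
  moreover have "e' \<notin> Ein" using e'(2) VF_translate_diff[OF e(2)] m0 by (auto simp: inner_edges_def)
  ultimately have "e' \<in> BN" by (simp add: edges_GN)
  moreover have "\<exists>n. e = tr n e" using edge_translate(5)[OF eG(1)] by metis
  ultimately have "e' = e" using BN_unique[OF eG(2)] e(1) e'_def by blast
  hence "Upair w p = Upair v (p - L m)" using e'(2) e(3) by simp
  hence "w = p - L m \<and> p = v" using \<open>w \<noteq> v\<close> by (auto simp: Upair_inject)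
  \<comment> \<open>The remaining case is again an edge reversed by a nonzero translation.\<close>
  hence "v + L m = v - L m" using wm by metis
  hence "2 *\<^sub>R L m = 0" by (simp add: scaleR_2 algebra_simps eq_neg_iff_add_eq_0)
  thus False using L_eq_0_iff[OF v(2)] m0 by simp
qed

section \<open>Translation invariance of edge counts and degrees\<close>

lemma edges_translate_bij:
  assumes "\<And>e. e \<in> edges G \<Longrightarrow> P (tr m e) \<longleftrightarrow> R e"
  shows "card {e\<in>edges G. P e} = card {e\<in>edges G. R e}"
proof (rule bij_betw_same_card[of "tr (- m)"])
  show "bij_betw (tr (- m)) {e\<in>edges G. P e} {e\<in>edges G. R e}"
    by (rule bij_betw_byWitness[of _ "tr m"])
       (use edge_translate assms in \<open>auto, (metis edge_translate)+\<close>)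
qed

lemma map_uprod_translate_eq_iff:
  "map_uprod (\<lambda>v. v + L m) x = Upair (u + L m) (w + L m) \<longleftrightarrow> x = Upair u w"
  by (cases x) (auto simp: Upair_inject)

lemma oriented_edges_translate:
  "oriented_edges G (u + L m) (w + L m) = oriented_edges G u w"
proof -
  have "card {e\<in>edges G. ends G e = Upair (u + L m) (w + L m)} =
      card {e\<in>edges G. ends G e = Upair u w}"
    by (rule edges_translate_bij[of _ m]) (simp add: edge_translate map_uprod_translate_eq_iff)
  thus ?thesis by (simp add: oriented_edges_def)
qed

lemma vdegree_translate: "vdegree G (v + L m) = vdegree G v"
proof -
  have "card {e\<in>edges G. v + L m \<in> set_uprod (ends G e)} =
      card {e\<in>edges G. v \<in> set_uprod (ends G e)}"
    by (rule edges_translate_bij[of _ m]) (auto simp: edge_translate uprod.set_map)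
  moreover have "card {e\<in>edges G. ends G e = Upair (v + L m) (v + L m)} =
      card {e\<in>edges G. ends G e = Upair v v}"
    by (rule edges_translate_bij[of _ m]) (simp add: edge_translate map_uprod_translate_eq_iff)
  ultimately show ?thesis by (simp add: vdegree_def)
qed

text \<open>The supremum is a genuine bound because degrees are periodic: all their values already
  occur on the finite set \<open>VF\<close>.\<close>

lemma vdegree_le_max_degree: "v \<in> V \<Longrightarrow> real (vdegree G v) \<le> max_degree G"
  unfolding max_degree_def
proof (rule cSUP_upper)
  have "(\<lambda>v. real (vdegree G v)) ` V \<subseteq> (\<lambda>v. real (vdegree G v)) ` VF"
  proof safe
    fix w assume w: "w \<in> V"
    have "vdegree G w = vdegree G (base w)" using vdegree_translate[of "base w" "shift w"] by (simp add: base_plus)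
    thus "real (vdegree G w) \<in> (\<lambda>v. real (vdegree G v)) ` VF" using base_in[OF w] by auto
  qed
  thus "bdd_above ((\<lambda>v. real (vdegree G v)) ` V)"
    using finite_VF by (meson bdd_above_finite bdd_above_mono finite_imageI)
qed

end


subsection \<open>Quadratic forms of the Floquet and Neumann matrices\<close>

context fundamental_domain
begin

section \<open>Bloch functions and their edge energy\<close>

definition phase :: "real^'d \<Rightarrow> int^'d \<Rightarrow> complex" where
  "phase \<theta> m = exp (\<i> * of_real (\<Sum>s\<in>UNIV. of_int (m $ s) * \<theta> $ s))"

text \<open>The sign of the phase is that of \<open>floquet_mat\<close>: for \<open>u\<close> in the
  cell, the factor \<open>phase \<theta> m * f u\<close> belonging to an edge ending at
  \<open>u + L m\<close> is the value of the extension there.\<close>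

definition bloch :: "real^'d \<Rightarrow> (real^'d \<Rightarrow> complex) \<Rightarrow> real^'d \<Rightarrow> complex" where
  "bloch \<theta> f w = phase \<theta> (shift w) * f (base w)"

lemma phase_add: "phase \<theta> (m + n) = phase \<theta> m * phase \<theta> n"
  by (simp add: phase_def sum.distrib distrib_right distrib_left exp_add)

lemma phase_0 [simp]: "phase \<theta> 0 = 1"
  by (simp add: phase_def)

lemma cnj_phase: "cnj (phase \<theta> m) = phase \<theta> (- m)"
  by (simp add: phase_def exp_cnj sum_negf)

lemma cmod_phase [simp]: "cmod (phase \<theta> m) = 1"
  by (simp add: phase_def norm_exp_i_times)

lemma cmod_bloch: "cmod (bloch \<theta> f w) = cmod (f (base w))"
  by (simp add: bloch_def norm_mult)

lemma bloch_VF [simp]: "v \<in> VF \<Longrightarrow> bloch \<theta> f v = f v"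
  by (simp add: bloch_def)

text \<open>The share of one oriented edge in the form of the Laplacian, kept unsymmetric so that
  summing over \<open>w\<close> gives a row: degree term minus neighbour term. Only the two
  orientations together give the square of a difference.\<close>

definition edge_form :: "(real^'d \<Rightarrow> complex) \<Rightarrow> real^'d \<Rightarrow> real^'d \<Rightarrow> real" where
  "edge_form g v w = (cmod (g v))\<^sup>2 - Re (cnj (g v) * g w)"

text \<open>Both orientations of every edge occur, so this is the sum of the squared differences of
  \<open>g\<close> over the unoriented edges of \<open>GN\<close>; loops contribute 0.\<close>

definition energy :: "(real^'d \<Rightarrow> complex) \<Rightarrow> real" where
  "energy g = (\<Sum>v\<in>VN. \<Sum>w\<in>VN. real (oriented_edges GN v w) * edge_form g v w)"

text \<open>Both ends acquire the same phase, which cancels against its conjugate. This invariance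
  is what \<open>sum_oriented_edges_cell\<close> asks for.\<close>

lemma edge_form_bloch_translate:
  assumes "u \<in> V" "w \<in> V"
  shows "edge_form (bloch \<theta> f) (u + L m) (w + L m) = edge_form (bloch \<theta> f) u w"
proof -
  have "cnj (phase \<theta> m) * phase \<theta> m = 1"
    using phase_add[of \<theta> "- m" m] by (simp add: cnj_phase)
  moreover have "bloch \<theta> f (v + L m) = phase \<theta> m * bloch \<theta> f v" if "v \<in> V" for v
    using that by (simp add: bloch_def shift_translate base_translate phase_add)
  ultimately have "cnj (bloch \<theta> f (u + L m)) * bloch \<theta> f (w + L m) = cnj (bloch \<theta> f u) * bloch \<theta> f w"
    using assms by (simp add: algebra_simps)
  thus ?thesis using assms by (simp add: edge_form_def cmod_bloch base_translate)
qed

lemma sum_GN_symmetric: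
  fixes F :: "real^'d \<Rightarrow> real^'d \<Rightarrow> real"
  shows "(\<Sum>v\<in>VN. \<Sum>w\<in>VN. real (oriented_edges GN v w) * F v w) =
    (\<Sum>v\<in>VN. \<Sum>w\<in>VN. real (oriented_edges GN v w) * F w v)"
  by (subst sum.swap) (simp add: oriented_edges_commute)

lemma edge_form_symmetrized:
  "edge_form g v w + edge_form g w v = (cmod (g v - g w))\<^sup>2"
  unfolding edge_form_def cmod_power2 by (simp add: power2_eq_square algebra_simps)

lemma energy_nonneg: "energy g \<ge> 0"
proof -
  have "2 * energy g = (\<Sum>v\<in>VN. \<Sum>w\<in>VN. real (oriented_edges GN v w) * (edge_form g v w + edge_form g w v))"
    unfolding energy_def using sum_GN_symmetric[of "edge_form g"]
    by (simp add: distrib_left sum.distrib)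
  also have "\<dots> \<ge> 0" by (simp add: edge_form_symmetrized sum_nonneg)
  finally show ?thesis by simp
qed

lemma energy_bloch_le: "energy (bloch \<theta> f) \<le> 2 * max_degree G * (\<Sum>v\<in>VF. (cmod (f v))\<^sup>2)"
proof -
  let ?g = "bloch \<theta> f"
  have *: "edge_form ?g v w + edge_form ?g w v \<le> 2 * (cmod (?g v))\<^sup>2 + 2 * (cmod (?g w))\<^sup>2" for v w
  proof -
    have "(cmod (?g v - ?g w))\<^sup>2 \<le> (cmod (?g v) + cmod (?g w))\<^sup>2"
      by (intro power_mono norm_triangle_ineq4) auto
    also have "\<dots> \<le> 2 * (cmod (?g v))\<^sup>2 + 2 * (cmod (?g w))\<^sup>2"
      using zero_le_power2[of "cmod (?g v) - cmod (?g w)"] by (simp add: power2_sum power2_diff)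
    finally show ?thesis by (simp add: edge_form_symmetrized)
  qed
  have "2 * energy ?g = (\<Sum>v\<in>VN. \<Sum>w\<in>VN. real (oriented_edges GN v w) * (edge_form ?g v w + edge_form ?g w v))"
    unfolding energy_def using sum_GN_symmetric[of "edge_form ?g"]
    by (simp add: distrib_left sum.distrib)
  also have "\<dots> \<le> (\<Sum>v\<in>VN. \<Sum>w\<in>VN. real (oriented_edges GN v w) * (2 * (cmod (?g v))\<^sup>2 + 2 * (cmod (?g w))\<^sup>2))"
    by (intro sum_mono mult_left_mono *) auto
  also have "\<dots> = 4 * (\<Sum>v\<in>VN. \<Sum>w\<in>VN. real (oriented_edges GN v w) * (cmod (?g v))\<^sup>2)"
    using sum_GN_symmetric[of "\<lambda>v w. (cmod (?g v))\<^sup>2"]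
    by (simp add: distrib_left sum.distrib mult.left_commute[of _ 2] flip: sum_distrib_left)
  \<comment> \<open>Moving the sum back to the cell collects the partial degrees of all copies into
    the full degree in \<open>G\<close>.\<close>
  also have "(\<Sum>v\<in>VN. \<Sum>w\<in>VN. real (oriented_edges GN v w) * (cmod (?g v))\<^sup>2) =
      (\<Sum>v\<in>VF. \<Sum>w\<in>nbhd. real (oriented_edges G v w) * (cmod (?g v))\<^sup>2)"
    by (rule sum_oriented_edges_cell[symmetric]) (simp add: cmod_bloch base_translate)
  also have "\<dots> = (\<Sum>v\<in>VF. real (vdegree G v) * (cmod (f v))\<^sup>2)"
    by (simp add: vdegree_cell flip: sum_distrib_right)
  also have "\<dots> \<le> (\<Sum>v\<in>VF. max_degree G * (cmod (f v))\<^sup>2)"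
    using VF_subset by (intro sum_mono mult_right_mono vdegree_le_max_degree) auto
  finally show ?thesis by (simp flip: sum_distrib_left)
qed

section \<open>The form of the Floquet matrix\<close>

definition floquet_kernel :: "(real^'d \<Rightarrow> real) \<Rightarrow> real^'d \<Rightarrow> real^'d \<Rightarrow> real^'d \<Rightarrow> complex" where
  "floquet_kernel Q \<theta> v u = (if v = u then of_nat (vdegree G v) + of_real (Q v) else 0)
     - (\<Sum>m | oriented_edges G v (u + L m) \<noteq> 0. of_nat (oriented_edges G v (u + L m)) * phase \<theta> m)"

lemma floquet_mat_carrier: "floquet_mat a G Q xs \<theta> \<in> carrier_mat (length xs) (length xs)"
  by (simp add: floquet_mat_def)

lemma floquet_mat_index:
  assumes "distinct xs" "i < length xs" "j < length xs"
  shows "floquet_mat a G Q xs \<theta> $$ (i, j) = floquet_kernel Q \<theta> (xs ! i) (xs ! j)"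
  using assms by (simp add: floquet_mat_def floquet_kernel_def phase_def nth_eq_iff_index_eq)

text \<open>Reversing an oriented edge and translating its new start back replaces \<open>m\<close>
  by \<open>- m\<close>, which conjugates the phase.\<close>

lemma floquet_kernel_hermitian: "floquet_kernel Q \<theta> v u = cnj (floquet_kernel Q \<theta> u v)"
proof -
  have *: "oriented_edges G u (v - L m) = oriented_edges G v (u + L m)" for u v m
    using oriented_edges_translate[of u m "v - L m"] by (simp add: oriented_edges_commute)
  have "(\<Sum>m | oriented_edges G v (u + L m) \<noteq> 0. of_nat (oriented_edges G v (u + L m)) * phase \<theta> m) =
      (\<Sum>m | oriented_edges G u (v + L m) \<noteq> 0. of_nat (oriented_edges G u (v + L m)) * phase \<theta> (- m))"
    by (rule sum.reindex_bij_witness[of _ uminus uminus]) (auto simp: lattice_vec_uminus *)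
  thus ?thesis by (simp add: floquet_kernel_def cnj_phase)
qed

lemma hermitian_floquet_mat: "distinct xs \<Longrightarrow> hermitian_mat (floquet_mat a G Q xs \<theta>)"
  by (rule hermitian_mat_carrierI[OF floquet_mat_carrier])
     (simp add: floquet_mat_index floquet_kernel_hermitian[symmetric])

text \<open>A pair of a cell vertex \<open>u\<close> and a shift \<open>m\<close> is the same as the
  vertex \<open>u + L m\<close>. Under this reindexing the phases are absorbed into the Bloch
  function, and each row becomes a sum over neighbours in \<open>G\<close>.\<close>

lemma hform_floquet:
  assumes xs: "distinct xs" "set xs = VF"
  shows "hform (floquet_mat a G Q xs \<theta>) (\<lambda>i. f (xs ! i)) =
    (\<Sum>v\<in>VF. Q v * (cmod (f v))\<^sup>2) + energy (bloch \<theta> f)"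
proof -
  let ?g = "bloch \<theta> f"
  have row: "Re (\<Sum>u\<in>VF. cnj (f v) * floquet_kernel Q \<theta> v u * f u) =
      Q v * (cmod (f v))\<^sup>2 + (\<Sum>w\<in>nbhd. real (oriented_edges G v w) * edge_form ?g v w)"
    if v: "v \<in> VF" for v
  proof -
    define M where "M u = {m. oriented_edges G v (u + L m) \<noteq> 0}" for u
    define T where "T u m = cnj (f v) * (of_nat (oriented_edges G v (u + L m)) * phase \<theta> m) * f u" for u m
    \<comment> \<open>A sum over an infinite set would be 0 by convention; the shifts that occur
      inject into \<open>nbhd\<close>.\<close>
    have fM: "finite (M u)" if "u \<in> VF" for u
    proof (rule inj_on_finite[OF _ _ finite_nbhd])
      show "inj_on (\<lambda>m. u + L m) (M u)"
        using that shift_translate[of u] VF_subset by (intro inj_on_inverseI[of _ shift]) auto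
      show "(\<lambda>m. u + L m) ` M u \<subseteq> nbhd" using oriented_edges_nbhd[OF v] by (auto simp: M_def)
    qed
    have orV: "w \<in> V" if "oriented_edges G v w \<noteq> 0" for w
      using oriented_edges_nonzeroE[OF that] ends_in_verts by metis
    have "(\<Sum>u\<in>VF. \<Sum>m\<in>M u. T u m) = (\<Sum>(u, m)\<in>Sigma VF M. T u m)"
      using finite_VF fM by (intro sum.Sigma) auto
    also have "\<dots> = (\<Sum>w\<in>{w\<in>nbhd. oriented_edges G v w \<noteq> 0}. T (base w) (shift w))"
    proof (rule sum.reindex_bij_witness[of _ "\<lambda>w. (base w, shift w)" "\<lambda>(u, m). u + L m"], goal_cases)
      case (1 x)
      thus ?case using VF_subset by (auto simp: base_translate shift_translate subset_iff)
    next
      case (2 x)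
      thus ?case using oriented_edges_nbhd[OF v] by (auto simp: M_def)
    next
      case (3 w) thus ?case by (simp add: base_plus)
    next
      case (4 w) thus ?case using base_in orV by (auto simp: M_def base_plus)
    next
      case (5 x)
      thus ?case using VF_subset by (auto simp: base_translate shift_translate subset_iff)
    qed
    also have "\<dots> = (\<Sum>w\<in>nbhd. T (base w) (shift w))"
      using finite_nbhd by (intro sum.mono_neutral_left) (auto simp: T_def base_plus)
    also have "\<dots> = (\<Sum>w\<in>nbhd. of_nat (oriented_edges G v w) * (cnj (?g v) * ?g w))"
      using v by (simp add: T_def base_plus bloch_def mult_ac)
    finally have off: "(\<Sum>u\<in>VF. \<Sum>m\<in>M u. T u m) =
        (\<Sum>w\<in>nbhd. of_nat (oriented_edges G v w) * (cnj (?g v) * ?g w))" .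
    have "(\<Sum>u\<in>VF. cnj (f v) * floquet_kernel Q \<theta> v u * f u) =
        (\<Sum>u\<in>VF. if u = v then cnj (f v) * (of_nat (vdegree G v) + of_real (Q v)) * f v else 0) -
        (\<Sum>u\<in>VF. \<Sum>m\<in>M u. T u m)"
      unfolding sum_subtractf[symmetric]
      by (intro sum.cong refl)
         (auto simp: floquet_kernel_def T_def M_def algebra_simps sum_distrib_left sum_distrib_right)
    also have "\<dots> = cnj (f v) * (of_nat (vdegree G v) + of_real (Q v)) * f v -
        (\<Sum>w\<in>nbhd. of_nat (oriented_edges G v w) * (cnj (?g v) * ?g w))"
      using v finite_VF by (simp add: off sum.delta)
    also have "cnj (f v) * (of_nat (vdegree G v) + of_real (Q v)) * f v =
        of_real ((real (vdegree G v) + Q v) * (cmod (f v))\<^sup>2)"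
      using complex_norm_square[of "f v"] by (simp add: mult_ac)
    finally have re: "Re (\<Sum>u\<in>VF. cnj (f v) * floquet_kernel Q \<theta> v u * f u) =
        (real (vdegree G v) + Q v) * (cmod (f v))\<^sup>2 -
        (\<Sum>w\<in>nbhd. real (oriented_edges G v w) * Re (cnj (?g v) * ?g w))"
      by simp
    have "(\<Sum>w\<in>nbhd. real (oriented_edges G v w) * edge_form ?g v w) =
        real (vdegree G v) * (cmod (f v))\<^sup>2 -
        (\<Sum>w\<in>nbhd. real (oriented_edges G v w) * Re (cnj (?g v) * ?g w))"
      using v by (simp only: vdegree_cell edge_form_def sum_subtractf sum_distrib_right
          right_diff_distrib bloch_VF)
    thus ?thesis unfolding re distrib_right by linarith
  qed
  have "hform (floquet_mat a G Q xs \<theta>) (\<lambda>i. f (xs ! i)) =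
      (\<Sum>v\<in>VF. Re (\<Sum>u\<in>VF. cnj (f v) * floquet_kernel Q \<theta> v u * f u))"
    using hform_op_sum[OF xs(1) floquet_mat_carrier floquet_mat_index[OF xs(1)]] xs(2) by simp
  also have "\<dots> = (\<Sum>v\<in>VF. Q v * (cmod (f v))\<^sup>2 +
      (\<Sum>w\<in>nbhd. real (oriented_edges G v w) * edge_form ?g v w))"
    by (rule sum.cong[OF refl row])
  also have "\<dots> = (\<Sum>v\<in>VF. Q v * (cmod (f v))\<^sup>2) +
      (\<Sum>v\<in>VF. \<Sum>w\<in>nbhd. real (oriented_edges G v w) * edge_form ?g v w)"
    by (rule sum.distrib)
  also have "(\<Sum>v\<in>VF. \<Sum>w\<in>nbhd. real (oriented_edges G v w) * edge_form ?g v w) = energy ?g"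
    unfolding energy_def by (rule sum_oriented_edges_cell) (rule edge_form_bloch_translate)
  finally show ?thesis .
qed

section \<open>The form of the Neumann matrix\<close>

definition neumann_kernel :: "(real^'d \<Rightarrow> real) \<Rightarrow> real^'d \<Rightarrow> real^'d \<Rightarrow> real" where
  "neumann_kernel Q v w = (if v = w then real (rho a GN v) * real (vdegree GN v) + Q v else 0)
     - sqrt (rho a GN v) * real (oriented_edges GN v w) * sqrt (rho a GN w)"

abbreviation neumann_mat where "neumann_mat Q xs \<equiv> op_mat xs (neumann_op a GN Q)"

lemma neumann_mat_carrier: "neumann_mat Q xs \<in> carrier_mat (length xs) (length xs)"
  by (simp add: op_mat_def)

lemma neumann_mat_index:
  assumes "distinct xs" "set xs \<subseteq> VN" "i < length xs" "j < length xs"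
  shows "neumann_mat Q xs $$ (i, j) = of_real (neumann_kernel Q (xs ! i) (xs ! j))"
proof -
  have "xs ! j \<in> VN" using assms by auto
  hence "(\<Sum>u\<in>VN. of_nat (oriented_edges GN v u) * complex_of_real (sqrt (rho a GN u)) *
      (if u = xs ! j then 1 else 0)) =
      of_nat (oriented_edges GN v (xs ! j)) * complex_of_real (sqrt (rho a GN (xs ! j)))" for v
    using finite_VN by (simp add: if_distrib sum.delta cong: if_cong)
  thus ?thesis using assms
    by (simp add: op_mat_def neumann_op_def neumann_kernel_def)
qed

lemma hermitian_neumann_mat:
  assumes "distinct xs" "set xs \<subseteq> VN"
  shows "hermitian_mat (neumann_mat Q xs)"
proof (rule hermitian_mat_carrierI[OF neumann_mat_carrier])
  have "neumann_kernel Q v w = neumann_kernel Q w v" for v w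
    by (simp add: neumann_kernel_def oriented_edges_commute[of _ v w])
  thus "neumann_mat Q xs $$ (i, j) = cnj (neumann_mat Q xs $$ (j, i))"
    if "i < length xs" "j < length xs" for i j
    using that by (simp add: neumann_mat_index[OF assms])
qed

text \<open>After dividing by the root of \<open>rho\<close>, the factor \<open>rho\<close> on the
  diagonal and the two roots off the diagonal cancel, leaving the unweighted \<open>energy\<close>.
  The potential keeps a weight \<open>1 / rho\<close>, which \<open>sum_VN_rho\<close> sums over
  each orbit.\<close>

lemma hform_neumann:
  assumes xs: "distinct xs" "set xs = VN" and Q: "periodic_potential a G Q"
  shows "hform (neumann_mat Q xs) (\<lambda>i. bloch \<theta> f (xs ! i) / sqrt (rho a GN (xs ! i))) =
    (\<Sum>v\<in>VF. Q v * (cmod (f v))\<^sup>2) + energy (bloch \<theta> f)"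
proof -
  let ?g = "bloch \<theta> f"
  let ?y = "\<lambda>w. ?g w / complex_of_real (sqrt (rho a GN w))"
  have row: "Re (\<Sum>w\<in>VN. cnj (?y v) * of_real (neumann_kernel Q v w) * ?y w) =
      Q (base v) * (cmod (f (base v)))\<^sup>2 / rho a GN v +
      (\<Sum>w\<in>VN. real (oriented_edges GN v w) * edge_form ?g v w)"
    if v: "v \<in> VN" for v
  proof -
    define r where "r w = complex_of_real (sqrt (rho a GN w))" for w
    have r: "r w \<noteq> 0" "cnj (r w) = r w" "r w * r w = of_nat (rho a GN w)" if "w \<in> VN" for w
      using rho_pos[OF that] by (auto simp: r_def simp flip: of_real_mult)
    have Qb: "Q (base v) = Q v"
    proof -
      have "base v \<in> V" using base_in v VN_subset VF_subset by (auto simp: subset_iff)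
      hence "Q (base v + L (shift v)) = Q (base v)" using Q unfolding periodic_potential_def by blast
      thus ?thesis by (simp add: base_plus)
    qed
    have "cnj (?y v) * of_real (neumann_kernel Q v w) * ?y w =
        (if w = v then of_real (vdegree GN v * (cmod (?g v))\<^sup>2 + Q v * (cmod (?g v))\<^sup>2 / rho a GN v) else 0) -
        of_nat (oriented_edges GN v w) * (cnj (?g v) * ?g w)" if w: "w \<in> VN" for w
    proof -
      have k: "complex_of_real (neumann_kernel Q v w) =
          (if w = v then of_nat (rho a GN v) * of_nat (vdegree GN v) + of_real (Q v) else 0) -
          r v * of_nat (oriented_edges GN v w) * r w"
        by (simp add: neumann_kernel_def r_def)
      have off: "cnj (?g v / r v) * (r v * of_nat (oriented_edges GN v w) * r w) * (?g w / r w) =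
          of_nat (oriented_edges GN v w) * (cnj (?g v) * ?g w)"
        using r[OF v] r[OF w] by (simp add: field_simps)
      have diag: "cnj (?g v / r v) * (of_nat (rho a GN v) * of_nat (vdegree GN v) + of_real (Q v)) * (?g v / r v) =
          of_real (vdegree GN v * (cmod (?g v))\<^sup>2 + Q v * (cmod (?g v))\<^sup>2 / rho a GN v)"
      proof -
        have "cnj (?g v / r v) * (of_nat (rho a GN v) * of_nat (vdegree GN v) + of_real (Q v)) * (?g v / r v) =
            (of_nat (rho a GN v) * of_nat (vdegree GN v) + of_real (Q v)) * (?g v * cnj (?g v)) / (r v * r v)"
          using r(2)[OF v] by simp
        also have "\<dots> = of_real (vdegree GN v * (cmod (?g v))\<^sup>2 + Q v * (cmod (?g v))\<^sup>2 / rho a GN v)"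
          unfolding r(3)[OF v] complex_norm_square[symmetric]
          using rho_pos[OF v] by (simp add: field_simps)
        finally show ?thesis .
      qed
      show ?thesis unfolding k r_def[symmetric] right_diff_distrib left_diff_distrib off
        by (cases "w = v") (simp_all only: if_True if_False diag mult_zero_right mult_zero_left simp_thms)
    qed
    hence "(\<Sum>w\<in>VN. cnj (?y v) * of_real (neumann_kernel Q v w) * ?y w) =
        (\<Sum>w\<in>VN. (if w = v then of_real (vdegree GN v * (cmod (?g v))\<^sup>2 + Q v * (cmod (?g v))\<^sup>2 / rho a GN v) else 0) -
        of_nat (oriented_edges GN v w) * (cnj (?g v) * ?g w))"
      by (intro sum.cong refl)
    also have "\<dots> = of_real (vdegree GN v * (cmod (?g v))\<^sup>2 + Q v * (cmod (?g v))\<^sup>2 / rho a GN v) -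
        (\<Sum>w\<in>VN. of_nat (oriented_edges GN v w) * (cnj (?g v) * ?g w))"
      using v finite_VN by (simp add: sum_subtractf sum.delta)
    finally have re: "Re (\<Sum>w\<in>VN. cnj (?y v) * of_real (neumann_kernel Q v w) * ?y w) =
        vdegree GN v * (cmod (?g v))\<^sup>2 + Q v * (cmod (?g v))\<^sup>2 / rho a GN v -
        (\<Sum>w\<in>VN. real (oriented_edges GN v w) * Re (cnj (?g v) * ?g w))" by simp
    have "(\<Sum>w\<in>VN. real (oriented_edges GN v w) * edge_form ?g v w) =
        real (vdegree GN v) * (cmod (?g v))\<^sup>2 -
        (\<Sum>w\<in>VN. real (oriented_edges GN v w) * Re (cnj (?g v) * ?g w))"
      by (simp only: vdegree_GN edge_form_def sum_subtractf sum_distrib_right right_diff_distrib)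
    thus ?thesis unfolding re cmod_bloch Qb by linarith
  qed
  have "hform (neumann_mat Q xs) (\<lambda>i. ?y (xs ! i)) =
      (\<Sum>v\<in>VN. Re (\<Sum>w\<in>VN. cnj (?y v) * of_real (neumann_kernel Q v w) * ?y w))"
    using hform_op_sum[OF xs(1) neumann_mat_carrier neumann_mat_index[OF xs(1)], of Q ?y] xs(2) by simp
  also have "\<dots> = (\<Sum>v\<in>VN. Q (base v) * (cmod (f (base v)))\<^sup>2 / rho a GN v +
      (\<Sum>w\<in>VN. real (oriented_edges GN v w) * edge_form ?g v w))"
    by (rule sum.cong[OF refl row])
  also have "\<dots> = (\<Sum>v\<in>VN. Q (base v) * (cmod (f (base v)))\<^sup>2 / rho a GN v) + energy ?g"
    unfolding energy_def by (rule sum.distrib)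
  also have "(\<Sum>v\<in>VN. Q (base v) * (cmod (f (base v)))\<^sup>2 / rho a GN v) = (\<Sum>v\<in>VF. Q v * (cmod (f v))\<^sup>2)"
    by (rule sum_VN_rho)
  finally show ?thesis .
qed


text \<open>There are three isometric comparison maps: \<open>T\<close> from Floquet to Neumann
  vectors, \<open>E\<close> from Dirichlet to Floquet vectors, and the identity for the diagonal
  matrices. Here \<open>j\<close> counts from 0, hence \<open>Suc\<close>; differences of dimensions
  enter where eigenvalues are counted from the top.\<close>

theorem eigval_bounds:
  fixes \<theta> :: "real^'d"
  assumes Q: "periodic_potential a G Q"
    and vs: "distinct vs" "set vs = VN" "set (take \<nu> vs) = VF"
      "set (take \<nu>D vs) = inner_verts G GN"
    and card: "\<nu> = card VF" "\<nu>D = card (inner_verts G GN)"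
    and inner: "inner_verts G GN \<subseteq> VF"
    and j: "j < \<nu>"
  defines "A \<equiv> neumann_mat Q vs"
    and "D \<equiv> neumann_mat Q (take \<nu>D vs)"
    and "B \<equiv> floquet_mat a G Q (take \<nu> vs) \<theta>"
  shows "eigval A (Suc j) \<le> eigval B (Suc j)"
    and "eigval B (Suc j) \<le> eigval A (Suc (j + card VN - \<nu>))"
    and "j < \<nu>D \<Longrightarrow> eigval B (Suc j) \<le> eigval D (Suc j)"
    and "\<nu> - \<nu>D \<le> j \<Longrightarrow> eigval D (Suc (j + \<nu>D - \<nu>)) \<le> eigval B (Suc j)"
    and "sort (map Q (take \<nu> vs)) ! j \<le> eigval B (Suc j)"
    and "eigval B (Suc j) \<le> sort (map Q (take \<nu> vs)) ! j + 2 * max_degree G"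
proof -
  define N where "N = card VN"
  define xs where "xs = take \<nu> vs"
  have len: "length vs = N" using vs by (simp add: N_def flip: distinct_card)
  have \<nu>N: "\<nu> \<le> N" unfolding card N_def using finite_VN VN_subset by (intro card_mono) auto
  have \<nu>D: "\<nu>D \<le> \<nu>" unfolding card using finite_VF inner by (intro card_mono) auto
  have xs: "distinct xs" "set xs = VF" "length xs = \<nu>"
    using vs len \<nu>N by (auto simp: xs_def)
  have A: "A \<in> carrier_mat N N" "hermitian_mat A"
    using neumann_mat_carrier[of vs Q] hermitian_neumann_mat[of vs Q] vs len by (auto simp: A_def)
  have B: "B \<in> carrier_mat \<nu> \<nu>" "hermitian_mat B"
    using floquet_mat_carrier[of Q xs \<theta>] hermitian_floquet_mat[of xs Q \<theta>] xs by (auto simp: B_def xs_def)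
  have subD: "set (take \<nu>D vs) \<subseteq> VN" "distinct (take \<nu>D vs)" "length (take \<nu>D vs) = \<nu>D"
    using vs inner VN_subset len \<nu>D \<nu>N by auto
  have D: "D \<in> carrier_mat \<nu>D \<nu>D" "hermitian_mat D"
    using neumann_mat_carrier[of "take \<nu>D vs" Q] hermitian_neumann_mat[OF subD(2,1)] subD(3)
    by (auto simp: D_def)
  have DA: "D $$ (i, j) = A $$ (i, j)" if "i < \<nu>D" "j < \<nu>D" for i j
    using that \<nu>D \<nu>N len vs subD
    by (simp add: D_def A_def neumann_mat_index)

  \<comment> \<open>Turns a vector on list positions into a function on vertices. It is applied to
    cell vertices only, where it really inverts the enumeration.\<close>
  define idx where "idx v = inv_into {..<\<nu>} ((!) xs) v" for v
  have bij: "bij_betw ((!) xs) {..<\<nu>} VF" using bij_betw_nth[OF xs(1)] xs by auto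
  have idx_nth: "idx (xs ! i) = i" if "i < \<nu>" for i
    using that bij by (simp add: idx_def bij_betw_def)
  define T where "T x i = bloch \<theta> (\<lambda>v. x (idx v)) (vs ! i) / sqrt (rho a GN (vs ! i))" for x i
  have Tlin: "T (\<lambda>i. \<Sum>l<k. c l * y l i) i = (\<Sum>l<k. c l * T (y l) i)" for k c y i
    by (simp add: T_def bloch_def sum_distrib_left sum_divide_distrib mult_ac)
  have normB: "(\<Sum>i<\<nu>. (cmod (x i))\<^sup>2) = (\<Sum>v\<in>VF. (cmod (x (idx v)))\<^sup>2)" for x
    using sum_nth_distinct[OF xs(1), of "\<lambda>v. (cmod (x (idx v)))\<^sup>2"] xs idx_nth by simp
  have Tiso: "(\<Sum>i<N. (cmod (T x i))\<^sup>2) = (\<Sum>i<\<nu>. (cmod (x i))\<^sup>2)" for x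
  proof -
    have "(\<Sum>i<N. (cmod (T x i))\<^sup>2) = (\<Sum>i<length vs. (cmod (x (idx (base (vs ! i)))))\<^sup>2 / rho a GN (vs ! i))"
      by (simp add: T_def norm_divide cmod_bloch power_divide len)
    also have "\<dots> = (\<Sum>w\<in>VN. (cmod (x (idx (base w))))\<^sup>2 / rho a GN w)"
      using sum_nth_distinct[OF vs(1)] vs(2) by simp
    also have "\<dots> = (\<Sum>v\<in>VF. (cmod (x (idx v)))\<^sup>2)" by (rule sum_VN_rho)
    finally show ?thesis by (simp add: normB)
  qed
  have formB: "hform B x = (\<Sum>v\<in>VF. Q v * (cmod (x (idx v)))\<^sup>2) + energy (bloch \<theta> (\<lambda>v. x (idx v)))" for x
  proof -
    have "hform B x = hform B (\<lambda>i. x (idx (xs ! i)))" by (rule hform_cong[OF B(1)]) (simp add: idx_nth)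
    also have "\<dots> = (\<Sum>v\<in>VF. Q v * (cmod (x (idx v)))\<^sup>2) + energy (bloch \<theta> (\<lambda>v. x (idx v)))"
      unfolding B_def xs_def[symmetric] by (rule hform_floquet[OF xs(1,2)])
    finally show ?thesis .
  qed
  have formA: "hform A (T x) = hform B x" for x
    unfolding A_def T_def formB by (rule hform_neumann[OF vs(1,2) Q])

  show "eigval A (Suc j) \<le> eigval B (Suc j)"
    by (rule eigval_le_of_hform_le[OF A B Tlin Tiso _ j \<nu>N]) (simp add: formA)
  show "eigval B (Suc j) \<le> eigval A (Suc (j + card VN - \<nu>))"
    unfolding N_def[symmetric]
    by (rule eigval_ge_of_hform_ge[OF A B Tlin Tiso _ j \<nu>N]) (simp add: formA)

  define E where "E x i = (if i < \<nu>D then x i else (0::complex))" for x and i :: nat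
  have Elin: "E (\<lambda>i. \<Sum>l<k. c l * y l i) i = (\<Sum>l<k. c l * E (y l) i)" for k c y i
    by (simp add: E_def)
  have Eiso: "(\<Sum>i<\<nu>. (cmod (E x i))\<^sup>2) = (\<Sum>i<\<nu>D. (cmod (x i))\<^sup>2)" for x
  proof -
    have "(\<Sum>i<\<nu>. (cmod (E x i))\<^sup>2) = (\<Sum>i<\<nu>D. (cmod (E x i))\<^sup>2)"
      using \<nu>D by (intro sum.mono_neutral_right) (auto simp: E_def)
    thus ?thesis by (simp add: E_def)
  qed
  have inner_idx: "vs ! i \<in> inner_verts G GN \<longleftrightarrow> i < \<nu>D" if "i < N" for i
  proof
    assume "vs ! i \<in> inner_verts G GN"
    then obtain k where k: "k < \<nu>D" "vs ! i = vs ! k"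
      using vs(4) subD(3) by (metis in_set_conv_nth nth_take)
    hence "i = k" using vs(1) that len \<nu>D \<nu>N by (simp add: nth_eq_iff_index_eq)
    thus "i < \<nu>D" using k by simp
  next
    assume "i < \<nu>D"
    thus "vs ! i \<in> inner_verts G GN" using vs(4) subD(3) by (metis nth_mem nth_take)
  qed
  \<comment> \<open>The composite is again extension by zero. At an inner vertex \<open>rho\<close>
    and the phase are 1; a vertex that is not inner has a base that is not inner, by
    \<open>inner_vert_unique\<close>, and \<open>E x\<close> vanishes there.\<close>
  have TE: "T (E x) i = (if i < \<nu>D then x i else 0)" if i: "i < N" for x i
  proof (cases "i < \<nu>D")
    case True
    let ?v = "vs ! i"
    have v: "?v \<in> inner_verts G GN" using True inner_idx i by simp
    hence vF: "?v \<in> VF" using inner by auto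
    have "{u\<in>VN. base u = base ?v} = {?v}"
      using inner_vert_unique[OF v vF] vF VN_subset by auto
    hence "rho a GN ?v = 1" using rho_eq[of ?v] vF VF_subset by auto
    moreover have "idx ?v = i" using idx_nth[of i] True \<nu>D by (simp add: xs_def)
    ultimately show ?thesis using True vF by (simp add: T_def E_def)
  next
    case False
    let ?w = "vs ! i"
    have w: "?w \<in> VN" using nth_mem[of i vs] i by (simp only: len vs(2))
    have bF: "base ?w \<in> VF" using base_in w VN_subset by auto
    hence "base ?w \<in> set xs" by (simp only: xs(2))
    then obtain k where k: "k < \<nu>" "xs ! k = base ?w"
      unfolding in_set_conv_nth xs(3) by blast
    have "\<not> k < \<nu>D"
    proof
      assume "k < \<nu>D"
      hence "base ?w \<in> inner_verts G GN" using inner_idx[of k] k \<nu>N by (simp add: xs_def)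
      from inner_vert_unique[OF this bF w refl] have "?w \<in> inner_verts G GN"
        using \<open>base ?w \<in> inner_verts G GN\<close> by simp
      thus False using inner_idx[OF i] False by simp
    qed
    moreover have "idx (base ?w) = k" using idx_nth[OF k(1)] k(2) by simp
    ultimately show ?thesis using False by (simp add: T_def bloch_def E_def)
  qed
  \<comment> \<open>The detour through \<open>A\<close> avoids the entries of the Floquet matrix:
    \<open>D\<close> is visibly a leading submatrix of \<open>A\<close>.\<close>
  have formD: "hform B (E x) = hform D x" for x
  proof -
    have "hform B (E x) = hform A (T (E x))" by (simp add: formA)
    also have "\<dots> = hform A (\<lambda>i. if i < \<nu>D then x i else 0)"
      by (rule hform_cong[OF A(1)]) (rule TE)
    also have "\<dots> = hform D x"
      by (rule hform_zero_pad[OF A(1) D(1)]) (use DA \<nu>D \<nu>N in auto)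
    finally show ?thesis .
  qed
  show "eigval B (Suc j) \<le> eigval D (Suc j)" if "j < \<nu>D"
    by (rule eigval_le_of_hform_le[OF B D Elin Eiso _ that \<nu>D]) (simp add: formD)
  show "eigval D (Suc (j + \<nu>D - \<nu>)) \<le> eigval B (Suc j)" if "\<nu> - \<nu>D \<le> j"
  proof -
    \<comment> \<open>The guard on \<open>j\<close> keeps the natural-number subtraction from
      truncating.\<close>
    have k: "j + \<nu>D - \<nu> < \<nu>D" "j + \<nu>D - \<nu> + \<nu> - \<nu>D = j" using that j \<nu>D by auto
    have "eigval D (Suc (j + \<nu>D - \<nu>)) \<le> eigval B (Suc (j + \<nu>D - \<nu> + \<nu> - \<nu>D))"
      by (rule eigval_ge_of_hform_ge[OF B D Elin Eiso _ k(1) \<nu>D]) (simp add: formD)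
    thus ?thesis unfolding k(2) .
  qed

  \<comment> \<open>Both uses stay in dimension \<open>\<nu>\<close>: \<open>c = 0\<close> rests on
    \<open>energy_nonneg\<close>, and \<open>c = 2 * max_degree G\<close> on
    \<open>energy_bloch_le\<close>.\<close>
  define P where "P c = mat \<nu> \<nu> (\<lambda>(i, j). if i = j then complex_of_real (Q (xs ! i) + c) else 0)" for c
  have P: "P c \<in> carrier_mat \<nu> \<nu>" "hermitian_mat (P c)" for c
    by (auto simp: P_def intro!: hermitian_mat_carrierI[of _ \<nu>])
  have formP: "hform (P c) x = (\<Sum>v\<in>VF. (Q v + c) * (cmod (x (idx v)))\<^sup>2)" for c x
  proof -
    have "hform (P c) x = (\<Sum>i<\<nu>. (Q (xs ! i) + c) * (cmod (x (idx (xs ! i))))\<^sup>2)"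
      unfolding P_def hform_diagonal by (simp add: idx_nth)
    also have "\<dots> = (\<Sum>v\<in>VF. (Q v + c) * (cmod (x (idx v)))\<^sup>2)"
      using sum_nth_distinct[OF xs(1), of "\<lambda>v. (Q v + c) * (cmod (x (idx v)))\<^sup>2"] xs by simp
    finally show ?thesis .
  qed
  have eigP: "eigval (P c) (Suc j) = sort (map Q xs) ! j + c" for c
  proof -
    have "map (\<lambda>i. Q (xs ! i) + c) [0..<\<nu>] = map (\<lambda>q. q + c) (map Q xs)"
      using xs(3) by (intro nth_equalityI) auto
    moreover have "sort (map (\<lambda>q. q + c) (map Q xs)) = map (\<lambda>q. q + c) (sort (map Q xs))"
      by (rule properties_for_sort) (simp_all add: sorted_wrt_map multiset.map_comp o_def)
    ultimately show ?thesis using xs(3) j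
      unfolding P_def eigval_diagonal by simp
  qed
  have "eigval (P 0) (Suc j) \<le> eigval B (Suc j)"
    by (rule eigval_le_of_hform_le[where T = "\<lambda>x. x", OF P B _ _ _ j order_refl])
       (simp_all add: formP formB energy_nonneg)
  thus "sort (map Q (take \<nu> vs)) ! j \<le> eigval B (Suc j)" by (simp add: eigP xs_def)
  have "eigval B (Suc j) \<le> eigval (P (2 * max_degree G)) (Suc j)"
    by (rule eigval_le_of_hform_le[where T = "\<lambda>x. x", OF B P _ _ _ j order_refl])
       (simp_all add: formP formB energy_bloch_le distrib_right sum.distrib flip: sum_distrib_left)
  thus "eigval B (Suc j) \<le> sort (map Q (take \<nu> vs)) ! j + 2 * max_degree G" by (simp add: eigP xs_def)
qed

end

theorem theorem1p1:
  fixes a :: "'d::finite \<Rightarrow> real^'d" and z :: "real^'d"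
    and G GN :: "(real^'d, 'e) mgraph"
    and tr :: "int^'d \<Rightarrow> 'e \<Rightarrow> 'e"
    and Q :: "real^'d \<Rightarrow> real"
    and VF VD :: "(real^'d) set" and BN :: "'e set"
    and vs :: "(real^'d) list"
    and \<nu> \<nu>N \<nu>D :: nat
    and lamN lamD q :: "nat \<Rightarrow> real"
  assumes "CARD('d) \<ge> 2"
    and "periodic_graph a G tr"
    and "periodic_potential a G Q"
    and "VF = cell_verts a z G"
    and "bridge_choice VF G tr BN"
    and "GN = finite_graph VF G BN"
    and "VD = inner_verts G GN"
    and "VD \<subseteq> VF"
    and "\<nu> = card VF" and "\<nu>N = card (verts GN)" and "\<nu>D = card VD"
    and "distinct vs" and "set vs = verts GN"
    and "set (take \<nu> vs) = VF" and "set (take \<nu>D vs) = VD"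
    and "\<And>n. lamN n = eigval (op_mat vs (neumann_op a GN Q)) n"
    and "\<And>n. lamD n = eigval (op_mat (take \<nu>D vs) (neumann_op a GN Q)) n"
    and "\<And>n. q n = sort (map Q (take \<nu> vs)) ! (n - 1)"
  shows "\<forall>n\<in>{1..\<nu>}. spectral_band a G Q (take \<nu> vs) n \<subseteq>
      (if n \<le> \<nu>D then {lamN n..lamD n} else {lamN n..q n + 2 * max_degree G}) \<inter>
      (if n \<le> \<nu> - \<nu>D then {q n..lamN (n + \<nu>N - \<nu>)}
       else {lamD (n + \<nu>D - \<nu>)..lamN (n + \<nu>N - \<nu>)})"
proof
  fix n assume n: "n \<in> {1..\<nu>}"
  interpret fundamental_domain a z G tr BN
    using assms(2,4,5) by unfold_locales simp_all
  obtain j where j: "n = Suc j" "j < \<nu>" using n by (cases n) auto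
  note [simp] = \<open>VF = _\<close> \<open>GN = _\<close> \<open>VD = _\<close>
  have fVN: "\<nu> \<le> \<nu>N"
    unfolding assms(9,10) using finite_VN VN_subset by (simp add: card_mono)
  note b = eigval_bounds[OF assms(3,12), of \<nu> \<nu>D j]
  have bounds:
    "lamN n \<le> eigval (floquet_mat a G Q (take \<nu> vs) \<theta>) n"
    "eigval (floquet_mat a G Q (take \<nu> vs) \<theta>) n \<le> lamN (n + \<nu>N - \<nu>)"
    "n \<le> \<nu>D \<Longrightarrow> eigval (floquet_mat a G Q (take \<nu> vs) \<theta>) n \<le> lamD n"
    "\<not> n \<le> \<nu> - \<nu>D \<Longrightarrow> lamD (n + \<nu>D - \<nu>) \<le> eigval (floquet_mat a G Q (take \<nu> vs) \<theta>) n"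
    "q n \<le> eigval (floquet_mat a G Q (take \<nu> vs) \<theta>) n"
    "eigval (floquet_mat a G Q (take \<nu> vs) \<theta>) n \<le> q n + 2 * max_degree G" for \<theta>
  proof -
    \<comment> \<open>With \<open>n = Suc j\<close>, the case \<open>n > \<nu> - \<nu>D\<close> is
      precisely \<open>\<nu> - \<nu>D \<le> j\<close>, so no subtraction truncates.\<close>
    have D: "Suc j + \<nu>D - \<nu> = Suc (j + \<nu>D - \<nu>)" if "\<nu> - \<nu>D \<le> j" using that j(2) by simp
    have N: "Suc j + \<nu>N - \<nu> = Suc (j + \<nu>N - \<nu>)" using fVN by simp
    note bs = b[where \<theta> = \<theta>]
    show "lamN n \<le> eigval (floquet_mat a G Q (take \<nu> vs) \<theta>) n"
      using bs(1) assms(6-16) j by simp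
    show "eigval (floquet_mat a G Q (take \<nu> vs) \<theta>) n \<le> lamN (n + \<nu>N - \<nu>)"
      using bs(2) assms(6-16) j N by simp
    show "n \<le> \<nu>D \<Longrightarrow> eigval (floquet_mat a G Q (take \<nu> vs) \<theta>) n \<le> lamD n"
      using bs(3) assms(6-17) j by simp
    show "\<not> n \<le> \<nu> - \<nu>D \<Longrightarrow> lamD (n + \<nu>D - \<nu>) \<le> eigval (floquet_mat a G Q (take \<nu> vs) \<theta>) n"
      using bs(4) assms(6-17) j D by simp
    show "q n \<le> eigval (floquet_mat a G Q (take \<nu> vs) \<theta>) n"
      using bs(5) assms(6-18) j by simp
    show "eigval (floquet_mat a G Q (take \<nu> vs) \<theta>) n \<le> q n + 2 * max_degree G"
      using bs(6) assms(6-18) j by simp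
  qed
  show "spectral_band a G Q (take \<nu> vs) n \<subseteq>
      (if n \<le> \<nu>D then {lamN n..lamD n} else {lamN n..q n + 2 * max_degree G}) \<inter>
      (if n \<le> \<nu> - \<nu>D then {q n..lamN (n + \<nu>N - \<nu>)}
       else {lamD (n + \<nu>D - \<nu>)..lamN (n + \<nu>N - \<nu>)})"
    \<comment> \<open>The bounds hold at every \<open>\<theta>\<close>, and the band is the range
      over \<open>\<theta>\<close>; each combination of cases selects four of the six.\<close>
    using bounds by (auto simp: spectral_band_def)
qed

end
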